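(* Let $N\ge2$, $1\le k<N$, $C=[0,\infty)^N$, and let $T:C\to C$ be given by $T_i(x)=x_if_i(x)$, $i=1,\dots,N$, where $f\in C^1(C,C)$ with $f_i(x)>0$ for all $x\in C$ and all $i$. Assume that the system $x(n)=T^n(x)$ is type-K competitive, that $f_i(\mathbf 0)>1$ for all $i$, and that the system is dissipative. Let $r\in\dot C$ be such that for each $x\in C$, $T^n(x)\in[\mathbf 0,r]$ for all large enough $n$. Assume moreover that $T([\mathbf 0,r])\subset[\mathbf 0,r)$ and that $T$ from $[\mathbf 0,r]$ to $T([\mathbf 0,r])$ is a homeomorphism and weakly type-K retrotone. Let $\Sigma,\Sigma_H,\Sigma_V,\Sigma_0$ be the sets defined in the context. Then: (a) The set $\Sigma_H\cap C_H=\Sigma\cap C_H$ (respectively $\Sigma_V\cap C_V=\Sigma\cap C_V$) is the global attractor of the system restricted to $C_H\setminus\{\mathbf 0\}$ (respectively $C_V\setminus\{\mathbf 0\}$), and it is a repeller on $\Sigma$. The set $\Sigma_0$ is nonempty, compact and invariant, and it is the global attractor of the system on $C\setminus(C_H\cup C_V)$. (b) The sets $\Sigma_H\cup\Sigma_0$ and $\Sigma_V\cup\Sigma_0$ are unordered in $\ll_K$. If $T$ is type-K retrotone on $[\mathbf 0,r]$, then "$\ll_K$" in conclusion (b) is replaced by "$<_K$".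
   Context: Notation: $\dot C=(0,\infty)^N$; $H=\{1,\dots,k\}$, $V=\{k+1,\dots,N\}$; $x\le y$ means $y-x\in C$, $x\ll y$ means $y-x\in\dot C$; $[\mathbf 0,r]=\{z\in C:z\le r\}$, $[\mathbf 0,r)=\{z\in C: z\ll r\}$. $C_H=\{x\in C:x_j=0\ \forall j\in V\}$, $C_V=\{x\in C:x_i=0\ \forall i\in H\}$. $K=\{p\in\mathbb R^N:p_i\ge0\ \forall i\in H,\ p_j\le0\ \forall j\in V\}$ with interior $\dot K$; $x\le_K y$ means $y-x\in K$; $x<_K y$ means $x\le_K y$, $x\ne y$; $x\ll_K y$ means $y-x\in\dot K$. A set is unordered in $\ll_K$ (respectively $<_K$) if no two of its points $x,y$ satisfy $x\ll_K y$ (respectively $x<_K y$). The system is type-K competitive if for all $x\in C$ the Jacobian $Df(x)=(\partial f_i/\partial x_j)$ has block form $\begin{pmatrix}A_1 & B_1 \\ B_2 & A_2\end{pmatrix}$, where $A_1$ ($k\times k$) and $A_2$ ($(N-k)\times(N-k)$) have nonpositive entries with each diagonal entry negative, and $B_1,B_2$ have nonnegative entries. It is dissipative if there is a bounded $B\subset C$ such that for each $x\in C$, $T^n(x)\in B$ for all large enough $n$. $T$ is type-K retrotone on $X\subset C$ if for any $x,y\in X$, $T(x)<_K T(y)$ implies $x<_K y$ and, for each $i\in H$ and $j\in V$, if $y_i\ne0$ then $x_i<y_i$, and if $x_j\ne0$ then $x_j>y_j$. $T$ is weakly type-K retrotone on $X$ if for any $x,y\in X$, $T(x)<_K T(y)$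 implies $x<_K y$ and, for each $i\in H$ and $j\in V$, if $T_i(x)<T_i(y)$ then $x_i<y_i$, and if $T_j(x)>T_j(y)$ then $x_j>y_j$. $q$ is a point with $\mathbf 0\ll q\ll r$ such that $f_i(x)>1$ for all $i$ and all $x\in[\mathbf 0,q]$, $T([\mathbf 0,r]\setminus[\mathbf 0,q))\subset[\mathbf 0,r]\setminus[\mathbf 0,q)$ and $[\mathbf 0,q]\subset T([\mathbf 0,q])$ (such $q$ exists because $f_i(\mathbf 0)>1$ for all $i$). $\Sigma=\bigcap_{n=0}^\infty T^n([\mathbf 0,r]\setminus[\mathbf 0,q))$, a nonempty compact set with $T(\Sigma)=\Sigma$. $T^{-1}:T([\mathbf 0,r])\to[\mathbf 0,r]$ is the inverse of the homeomorphism $T|_{[\mathbf 0,r]}$; all iterates $T^{-n}$ are defined on $\Sigma$. For $x\in\Sigma$, $\alpha(x)=\bigcap_{n\ge0}\overline{\{T^{-m}(x):m\ge n\}}$. Define $\Sigma_H=\{x\in\Sigma:\alpha(x)\subset\Sigma\cap C_H\}$, $\Sigma_V=\{x\in\Sigma:\alpha(x)\subset\Sigma\cap C_V\}$, $\Sigma_0=\Sigma\setminus(\Sigma_H\cup\Sigma_V)$. Invariant means $T(\Gamma)=\Gamma$. A nonempty compact invariant set $\Gamma\subset Y$ is the global attractor on a forward invariant set $Y$ if it attracts the points of each compact subset of $Y$ uniformly, i.e. $\operatorname{dist}(T^n(x),\Gamma)\to0$ uniformly for $x$ in each compact subset of $Y$. A compact invariant set $\Gamma\subset\Sigma$ is a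 repeller on $\Sigma$ if it has a neighbourhood $U$ in $\Sigma$ such that for every $x\in U\setminus\Gamma$ there is $n_0$ with $T^n(x)\notin U$ for all $n\ge n_0$. *)

theory Defs
  imports "HOL-Analysis.Analysis"
begin

text \<open>
  Points of Euclidean N-space are vectors of type \<open>real^'n\<close>, so N is \<open>CARD('n)\<close>.  The splitting of
  the coordinates into H (k elements) and V (the other N - k) is given by a set \<open>H :: 'n set\<close>; its
  complement \<open>- H\<close> is V.
\<close>

definition orthant :: "(real^'n) set" where
  "orthant = {x. \<forall>i. 0 \<le> x $ i}"

definition open_orthant :: "(real^'n) set" where
  "open_orthant = {x. \<forall>i. 0 < x $ i}"

definition vll :: "real^'n \<Rightarrow> real^'n \<Rightarrow> bool" where
  "vll x y \<longleftrightarrow> y - x \<in> open_orthant"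

text \<open>
  The closed box \<open>[0, r]\<close> is the library interval \<open>{0..r}\<close> for the componentwise order.  The following
  half-open box still contains the points of the faces \<open>x $ i = 0\<close>.
\<close>
definition half_open_box :: "real^'n \<Rightarrow> (real^'n) set" where
  "half_open_box r = {z \<in> orthant. vll z r}"

definition face_H :: "'n set \<Rightarrow> (real^'n) set" where
  "face_H H = {x \<in> orthant. \<forall>j. j \<notin> H \<longrightarrow> x $ j = 0}"

definition face_V :: "'n set \<Rightarrow> (real^'n) set" where
  "face_V H = {x \<in> orthant. \<forall>i\<in>H. x $ i = 0}"

definition coneK :: "'n set \<Rightarrow> (real^'n) set" where
  "coneK H = {p. (\<forall>i\<in>H. 0 \<le> p $ i) \<and> (\<forall>j. j \<notin> H \<longrightarrow> p $ j \<le> 0)}"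

definition leK :: "'n set \<Rightarrow> real^'n \<Rightarrow> real^'n \<Rightarrow> bool" where
  "leK H x y \<longleftrightarrow> y - x \<in> coneK H"

definition lessK :: "'n set \<Rightarrow> real^'n \<Rightarrow> real^'n \<Rightarrow> bool" where
  "lessK H x y \<longleftrightarrow> leK H x y \<and> x \<noteq> y"

definition llK :: "'n set \<Rightarrow> real^'n \<Rightarrow> real^'n \<Rightarrow> bool" where
  "llK H x y \<longleftrightarrow> y - x \<in> interior (coneK H)"

definition unordered_in :: "('a \<Rightarrow> 'a \<Rightarrow> bool) \<Rightarrow> 'a set \<Rightarrow> bool" where
  "unordered_in R S \<longleftrightarrow> \<not> (\<exists>x\<in>S. \<exists>y\<in>S. R x y)"

definition kolmogorov_map :: "(real^'n \<Rightarrow> real^'n) \<Rightarrow> real^'n \<Rightarrow> real^'n" where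
  "kolmogorov_map f x = (\<chi> i. x $ i * f x $ i)"

text \<open>
  The orthant is closed, so derivatives on it are taken within it (one-sided on the boundary).
  They are unique, because the orthant has nonempty interior and is convex.
\<close>
definition C1_on :: "(real^'n) set \<Rightarrow> (real^'n \<Rightarrow> real^'n) \<Rightarrow> bool" where
  "C1_on S f \<longleftrightarrow> f differentiable_on S \<and> continuous_on S (\<lambda>x. jacobian f (at x within S))"

definition typeK_competitive :: "'n set \<Rightarrow> (real^'n \<Rightarrow> real^'n) \<Rightarrow> bool" where
  "typeK_competitive H f \<longleftrightarrow>
     (\<forall>x\<in>orthant. let D = jacobian f (at x within orthant) in
        (\<forall>i j. (i \<in> H \<longleftrightarrow> j \<in> H) \<longrightarrow> D $ i $ j \<le> 0) \<and>
        (\<forall>i. D $ i $ i < 0) \<and>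
        (\<forall>i j. \<not> (i \<in> H \<longleftrightarrow> j \<in> H) \<longrightarrow> 0 \<le> D $ i $ j))"

definition dissipative :: "(real^'n \<Rightarrow> real^'n) \<Rightarrow> bool" where
  "dissipative T \<longleftrightarrow>
     (\<exists>B\<subseteq>orthant. bounded B \<and> (\<forall>x\<in>orthant. \<forall>\<^sub>F n in sequentially. (T ^^ n) x \<in> B))"

definition typeK_retrotone_on ::
  "'n set \<Rightarrow> (real^'n \<Rightarrow> real^'n) \<Rightarrow> (real^'n) set \<Rightarrow> bool" where
  "typeK_retrotone_on H T X \<longleftrightarrow>
     (\<forall>x\<in>X. \<forall>y\<in>X. lessK H (T x) (T y) \<longrightarrow>
        lessK H x y \<and>
        (\<forall>i\<in>H. y $ i \<noteq> 0 \<longrightarrow> x $ i < y $ i) \<and>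
        (\<forall>j. j \<notin> H \<longrightarrow> x $ j \<noteq> 0 \<longrightarrow> x $ j > y $ j))"

definition weakly_typeK_retrotone_on ::
  "'n set \<Rightarrow> (real^'n \<Rightarrow> real^'n) \<Rightarrow> (real^'n) set \<Rightarrow> bool" where
  "weakly_typeK_retrotone_on H T X \<longleftrightarrow>
     (\<forall>x\<in>X. \<forall>y\<in>X. lessK H (T x) (T y) \<longrightarrow>
        lessK H x y \<and>
        (\<forall>i\<in>H. T x $ i < T y $ i \<longrightarrow> x $ i < y $ i) \<and>
        (\<forall>j. j \<notin> H \<longrightarrow> T x $ j > T y $ j \<longrightarrow> x $ j > y $ j))"

definition Sigma_set :: "(real^'n \<Rightarrow> real^'n) \<Rightarrow> real^'n \<Rightarrow> real^'n \<Rightarrow> (real^'n) set" where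
  "Sigma_set T r q = (\<Inter>n. (T ^^ n) ` ({0..r} - half_open_box q))"

definition alpha_limit :: "(real^'n \<Rightarrow> real^'n) \<Rightarrow> real^'n \<Rightarrow> real^'n \<Rightarrow> (real^'n) set" where
  "alpha_limit T r x = (\<Inter>n. closure {(inv_into {0..r} T ^^ m) x | m. m \<ge> n})"

definition Sigma_H ::
  "'n set \<Rightarrow> (real^'n \<Rightarrow> real^'n) \<Rightarrow> real^'n \<Rightarrow> real^'n \<Rightarrow> (real^'n) set" where
  "Sigma_H H T r q = {x \<in> Sigma_set T r q. alpha_limit T r x \<subseteq> Sigma_set T r q \<inter> face_H H}"

definition Sigma_V ::
  "'n set \<Rightarrow> (real^'n \<Rightarrow> real^'n) \<Rightarrow> real^'n \<Rightarrow> real^'n \<Rightarrow> (real^'n) set" where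
  "Sigma_V H T r q = {x \<in> Sigma_set T r q. alpha_limit T r x \<subseteq> Sigma_set T r q \<inter> face_V H}"

definition Sigma_0 ::
  "'n set \<Rightarrow> (real^'n \<Rightarrow> real^'n) \<Rightarrow> real^'n \<Rightarrow> real^'n \<Rightarrow> (real^'n) set" where
  "Sigma_0 H T r q = Sigma_set T r q - (Sigma_H H T r q \<union> Sigma_V H T r q)"

definition global_attractor_on ::
  "('a::metric_space \<Rightarrow> 'a) \<Rightarrow> 'a set \<Rightarrow> 'a set \<Rightarrow> bool" where
  "global_attractor_on T Y \<Gamma> \<longleftrightarrow>
     T ` Y \<subseteq> Y \<and> \<Gamma> \<noteq> {} \<and> compact \<Gamma> \<and> T ` \<Gamma> = \<Gamma> \<and> \<Gamma> \<subseteq> Y \<and>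
     (\<forall>X\<subseteq>Y. compact X \<longrightarrow>
        uniform_limit X (\<lambda>n x. infdist ((T ^^ n) x) \<Gamma>) (\<lambda>_. 0) sequentially)"

definition repeller_on ::
  "('a::topological_space \<Rightarrow> 'a) \<Rightarrow> 'a set \<Rightarrow> 'a set \<Rightarrow> bool" where
  "repeller_on T S \<Gamma> \<longleftrightarrow>
     compact \<Gamma> \<and> T ` \<Gamma> = \<Gamma> \<and> \<Gamma> \<subseteq> S \<and>
     (\<exists>U\<subseteq>S. (\<exists>W. openin (top_of_set S) W \<and> \<Gamma> \<subseteq> W \<and> W \<subseteq> U) \<and>
        (\<forall>x\<in>U - \<Gamma>. \<exists>n0. \<forall>n\<ge>n0. (T ^^ n) x \<notin> U))"

end

theory Submission
  imports Defs
begin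

text \<open>
  If \<open>x \<le>\<^sub>K y\<close> and \<open>i \<in> H\<close>, type-K competitiveness gives \<open>f\<^sub>i x - f\<^sub>i y \<ge> c (y\<^sub>i - x\<^sub>i)\<close> with \<open>c > 0\<close>.
  Comparing points \<open>x\<close> of \<open>C\<^sub>V\<close> with \<open>0\<close> yields \<open>f\<^sub>i x \<ge> f\<^sub>i 0 > 1\<close>, so the sum \<open>L\<close> of the
  H-coordinates grows geometrically near \<open>C\<^sub>V\<close>: for small \<open>\<epsilon>\<close> the set \<open>{L \<ge> \<epsilon>}\<close> is forward invariant
  and absorbs every orbit outside \<open>C\<^sub>V\<close>.  This gives the repeller, identifies \<open>\<Sigma> - \<Sigma>\<^sub>V\<close> with the points
  whose whole backward orbit satisfies \<open>L \<ge> \<epsilon>\<close>, and exhibits \<open>\<Sigma>\<^sub>0\<close> as the intersection of the forward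
  images of a compact absorbing set.

  Retrotonicity propagates an order relation between \<open>x\<close> and \<open>y\<close> in \<open>\<Sigma>\<close> to the backward orbits.
  There the ratios \<open>x\<^sub>i / y\<^sub>i\<close> for \<open>i \<in> H\<close> decrease, and the above inequality bounds \<open>x\<^sub>i\<close> by a multiple
  of the decrement.  So \<open>x\<^sub>i\<close> tends to \<open>0\<close> along the backward orbit, which forces \<open>x \<in> \<Sigma>\<^sub>V\<close>.
\<close>

section \<open>Iteration and global attractors in general\<close>

lemma geometric_growth_unbounded:
  fixes u :: "nat \<Rightarrow> real"
  assumes "u 0 > 0" "c > 1" "\<And>n. u (Suc n) \<ge> c * u n"
  obtains n where "u n > B"
proof -
  have pow: "u n \<ge> c ^ n * u 0" for n
  proof (induction n)
    case (Suc n)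
    have "c * (c ^ n * u 0) \<le> c * u n" using Suc \<open>c > 1\<close> by (intro mult_left_mono) auto
    also have "\<dots> \<le> u (Suc n)" by (rule assms(3))
    finally show ?case by (simp only: power_Suc mult.assoc)
  qed simp
  obtain n where "B / u 0 < c ^ n" using real_arch_pow[OF \<open>c > 1\<close>] by blast
  then have "B < c ^ n * u 0" using assms(1) by (simp add: field_simps)
  then show ?thesis using pow[of n] by (intro that[of n]) linarith
qed

lemma funpow_mem:
  assumes "T ` Y \<subseteq> Y" "x \<in> Y"
  shows "(T ^^ n) x \<in> Y"
  using assms by (induction n) auto

lemma funpow_diff_apply:
  assumes "k \<le> n"
  shows "(T ^^ (n - k)) ((T ^^ k) x) = (T ^^ n) x" "(T ^^ k) ((T ^^ (n - k)) x) = (T ^^ n) x"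
  using funpow_add[of "n - k" k T, THEN fun_cong, of x] funpow_add[of k "n - k" T, THEN fun_cong, of x] assms
  by simp_all

lemma continuous_on_funpow:
  fixes T :: "'a::topological_space \<Rightarrow> 'a"
  assumes "continuous_on Y T" "T ` Y \<subseteq> Y"
  shows "continuous_on Y (T ^^ n)"
proof (induction n)
  case 0
  then show ?case by (simp add: id_def)
next
  case (Suc n)
  have "(T ^^ n) ` Y \<subseteq> Y" using funpow_mem[OF assms(2)] by blast
  then have "continuous_on Y (T \<circ> (T ^^ n))"
    using Suc assms(1) by (blast intro: continuous_on_compose continuous_on_subset)
  then show ?case by simp
qed

lemma decseq_funpow_image:
  assumes "T ` G \<subseteq> G"
  shows "(T ^^ (n + k)) ` G \<subseteq> (T ^^ n) ` G"
  using funpow_mem[OF assms, of _ k] by (auto simp: funpow_add)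

text \<open>The images of the compact set \<open>G\<close> decrease, so they shrink to their
  intersection. Each orbit enters \<open>G\<close> through a relatively open set; hence nearby
  orbits enter at the same time, and a compact set of initial points is inside \<open>G\<close>
  after a common time.\<close>

lemma global_attractor_on_Inter:
  fixes T :: "'a::heine_borel \<Rightarrow> 'a"
  assumes cont: "continuous_on Y T" and TY: "T ` Y \<subseteq> Y"
    and G: "compact G" "G \<subseteq> Y" "G \<noteq> {}" "T ` G \<subseteq> G" "inj_on T G"
    and reach: "\<And>x. x \<in> Y \<Longrightarrow> \<exists>n W. open W \<and> (T ^^ n) x \<in> W \<and> W \<inter> Y \<subseteq> G"
  shows "global_attractor_on T Y (\<Inter>n. (T ^^ n) ` G)"
proof -
  define \<Gamma> where "\<Gamma> = (\<Inter>n. (T ^^ n) ` G)"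
  have comp: "compact ((T ^^ n) ` G)" for n
    using compact_continuous_image[OF continuous_on_subset[OF continuous_on_funpow[OF cont TY] G(2)] G(1)] .
  have dec: "(T ^^ n) ` G \<subseteq> (T ^^ m) ` G" if "m \<le> n" for m n
    using decseq_funpow_image[OF G(4), of m "n - m"] that by simp
  have sub: "(T ^^ n) ` G \<subseteq> G" for n using dec[of 0 n] by simp
  have "\<Gamma> \<noteq> {}" unfolding \<Gamma>_def
    using compact_nest[of "\<lambda>n. (T ^^ n) ` G"] comp dec G(3) by blast
  moreover have "\<Gamma> \<subseteq> G" using sub unfolding \<Gamma>_def by blast
  moreover have "compact \<Gamma>"
    unfolding \<Gamma>_def by (rule compact_Inter) (use comp in auto)
  moreover have "T ` \<Gamma> = \<Gamma>"
  proof -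
    \<comment> \<open>Injectivity on \<open>G\<close> lets the image pass through the
      intersection.\<close>
    have "T ` \<Gamma> = (\<Inter>n. T ` (T ^^ n) ` G)"
      unfolding \<Gamma>_def by (rule image_INT[OF G(5)]) (use sub in auto)
    also have "\<dots> = (\<Inter>n. (T ^^ Suc n) ` G)" by (simp add: image_comp)
    also have "\<dots> = \<Gamma>"
      unfolding \<Gamma>_def
    proof
      show "(\<Inter>n. (T ^^ Suc n) ` G) \<subseteq> (\<Inter>n. (T ^^ n) ` G)"
        using dec[OF le_SucI[OF order_refl]] by (intro INT_greatest) blast
    qed blast
    finally show ?thesis .
  qed
  moreover have "uniform_limit X (\<lambda>n x. infdist ((T ^^ n) x) \<Gamma>) (\<lambda>_. 0) sequentially"
    if X: "X \<subseteq> Y" "compact X" for X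
  proof -
    have "\<forall>x\<in>X. \<exists>n W. open W \<and> (T ^^ n) x \<in> W \<and> W \<inter> Y \<subseteq> G" using reach X by blast
    then obtain \<nu> W where W: "\<And>x. x \<in> X \<Longrightarrow> open (W x) \<and> (T ^^ \<nu> x) x \<in> W x \<and> W x \<inter> Y \<subseteq> G"
      by metis
    have "\<forall>x\<in>X. \<exists>A. open A \<and> A \<inter> Y = (T ^^ \<nu> x) -` W x \<inter> Y"
      using continuous_on_funpow[OF cont TY] W unfolding continuous_on_open_invariant by blast
    then obtain A where A: "\<And>x. x \<in> X \<Longrightarrow> open (A x) \<and> A x \<inter> Y = (T ^^ \<nu> x) -` W x \<inter> Y"
      by metis
    have "X \<subseteq> (\<Union>x\<in>X. A x)" using A W X(1) by blast
    then obtain F where F: "F \<subseteq> X" "finite F" "X \<subseteq> (\<Union>x\<in>F. A x)"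
      using compactE_image[OF X(2), of X A] A by metis
    \<comment> \<open>The sum bounds all entry times in \<open>F\<close> at once and makes sense for
      empty \<open>F\<close> too.\<close>
    define N where "N = (\<Sum>x\<in>F. \<nu> x)"
    have enter: "(T ^^ n) x \<in> G" if xn: "x \<in> X" "n \<ge> N" for n x
    proof -
      obtain z where z: "z \<in> F" "x \<in> A z" using F xn by blast
      then have "(T ^^ \<nu> z) x \<in> W z" using A[of z] F(1) X(1) xn by blast
      then have "(T ^^ \<nu> z) x \<in> G" using W[of z] z F(1) funpow_mem[OF TY] xn X(1) by blast
      moreover have "\<nu> z \<le> n" using z F(2) member_le_sum[of z F \<nu>] xn unfolding N_def by simp
      ultimately have "(T ^^ (n - \<nu> z)) ((T ^^ \<nu> z) x) \<in> G" using funpow_mem[OF G(4)] by blast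
      then show ?thesis by (simp only: funpow_diff_apply(1)[OF \<open>\<nu> z \<le> n\<close>])
    qed
    show ?thesis
    proof (rule uniform_limitI)
      fix e :: real assume "e > 0"
      \<comment> \<open>If every image met the closed set of points at distance at least
        \<open>e\<close> from \<Gamma>, these nested compact sets would share a point, lying in
        \<Gamma> and yet away from it.\<close>
      have "\<exists>k. (T ^^ k) ` G \<inter> {z. e \<le> infdist z \<Gamma>} = {}"
      proof (rule ccontr)
        assume contra: "\<not> ?thesis"
        have cl: "closed {z. e \<le> infdist z \<Gamma>}"
          by (intro closed_Collect_le continuous_intros)
        have "(\<Inter>k. (T ^^ k) ` G \<inter> {z. e \<le> infdist z \<Gamma>}) \<noteq> {}"
        proof (rule compact_nest)
          show "compact ((T ^^ k) ` G \<inter> {z. e \<le> infdist z \<Gamma>})" for k using comp cl by blast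
          show "(T ^^ n) ` G \<inter> {z. e \<le> infdist z \<Gamma>} \<subseteq> (T ^^ m) ` G \<inter> {z. e \<le> infdist z \<Gamma>}"
            if "m \<le> n" for m n using dec[OF that] by blast
        qed (use contra in auto)
        then obtain z where "z \<in> \<Gamma>" "e \<le> infdist z \<Gamma>" unfolding \<Gamma>_def by blast
        with \<open>e > 0\<close> show False by simp
      qed
      then obtain k where k: "(T ^^ k) ` G \<inter> {z. e \<le> infdist z \<Gamma>} = {}" ..
      have k: "infdist ((T ^^ k) z) \<Gamma> < e" if "z \<in> G" for z
        using k that by (meson disjoint_iff imageI mem_Collect_eq not_le)
      have "infdist ((T ^^ n) x) \<Gamma> < e" if "n \<ge> N + k" "x \<in> X" for n x
      proof -
        have "n - k \<ge> N" "k \<le> n" using that(1) by simp_all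
        then have "infdist ((T ^^ k) ((T ^^ (n - k)) x)) \<Gamma> < e" using that(2) by (intro k enter)
        then show ?thesis by (simp only: funpow_diff_apply(2)[OF \<open>k \<le> n\<close>])
      qed
      then show "\<forall>\<^sub>F n in sequentially. \<forall>x\<in>X. dist (infdist ((T ^^ n) x) \<Gamma>) 0 < e"
        unfolding eventually_sequentially by (intro exI[of _ "N + k"]) (simp add: infdist_nonneg)
    qed
  qed
  ultimately show ?thesis
    unfolding global_attractor_on_def \<Gamma>_def[symmetric] using TY G(2) by blast
qed

section \<open>Type-K order and the exchange of H and V\<close>

definition coord_sum :: "'n set \<Rightarrow> real^'n \<Rightarrow> real" where
  "coord_sum I x = (\<Sum>i\<in>I. x $ i)"

lemma leK_iff:
  "leK H x y \<longleftrightarrow> (\<forall>i\<in>H. x $ i \<le> y $ i) \<and> (\<forall>j. j \<notin> H \<longrightarrow> y $ j \<le> x $ j)"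
  unfolding leK_def coneK_def by auto

text \<open>A ball around \<open>y - x\<close> inside the cone contains its translates by
  \<open>e\<close> along each axis, towards the boundary of the cone; this makes the sign conditions
  strict.\<close>

lemma llK_imp:
  fixes x :: "real^'n"
  assumes "llK H x y"
  shows "leK H x y" and "i \<in> H \<Longrightarrow> x $ i < y $ i" and "j \<notin> H \<Longrightarrow> y $ j < x $ j"
proof -
  define p where "p = y - x"
  have "p \<in> interior (coneK H)" using assms unfolding llK_def p_def .
  then obtain e where e: "e > 0" "cball p e \<subseteq> coneK H"
    unfolding mem_interior_cball by blast
  then show "leK H x y" unfolding leK_def p_def by (auto dest: subsetD[of _ _ p] simp: p_def)
  have "p + s *\<^sub>R axis k 1 \<in> coneK H" if "\<bar>s\<bar> \<le> e" for k s
    using e that by (intro subsetD[OF e(2)]) (simp add: dist_norm norm_axis_1)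
  note ax = this
  show "x $ i < y $ i" if "i \<in> H"
    using ax[of "- e" i] e(1) that unfolding coneK_def p_def by (force simp: axis_def)
  show "y $ j < x $ j" if "j \<notin> H"
    using ax[of e j] e(1) that unfolding coneK_def p_def by (force simp: axis_def)
qed

lemma coneK_Compl: "coneK (- H) = uminus ` coneK H"
proof
  show "coneK (- H) \<subseteq> uminus ` coneK H"
  proof
    fix p assume "p \<in> coneK (- H)"
    then have "- p \<in> coneK H" by (auto simp: coneK_def)
    then show "p \<in> uminus ` coneK H" by force
  qed
qed (auto simp: coneK_def)

text \<open>The cone of \<open>- H\<close> is the negative of the cone of \<open>H\<close>, so both
  orders reverse. These rules bring results obtained at \<open>- H\<close> back to the original
  notation.\<close>

lemma Compl_simps:
  shows face_V_Compl: "face_V (- H) = face_H H"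
    and Sigma_V_Compl: "Sigma_V (- H) T r q = Sigma_H H T r q"
    and lessK_Compl: "lessK (- H) x y \<longleftrightarrow> lessK H y x"
    and llK_Compl: "llK (- H) x y \<longleftrightarrow> llK H y x"
    and typeK_competitive_Compl: "typeK_competitive (- H) f \<longleftrightarrow> typeK_competitive H f"
proof -
  show *: "face_V (- H) = face_H H" by (auto simp: face_V_def face_H_def)
  show "Sigma_V (- H) T r q = Sigma_H H T r q" by (simp add: Sigma_V_def Sigma_H_def *)
  show "lessK (- H) x y \<longleftrightarrow> lessK H y x" by (auto simp: lessK_def leK_iff)
  have "x - y \<in> interior (coneK H) \<longleftrightarrow> y - x \<in> uminus ` interior (coneK H)"
    by (metis (no_types, lifting) minus_diff_eq image_iff minus_minus)
  then show "llK (- H) x y \<longleftrightarrow> llK H y x"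
    unfolding llK_def coneK_Compl interior_negations[symmetric] by blast
  show "typeK_competitive (- H) f \<longleftrightarrow> typeK_competitive H f"
    by (simp add: typeK_competitive_def Let_def)
qed

lemma weakly_typeK_retrotone_on_Compl:
  "weakly_typeK_retrotone_on (- H) T X \<longleftrightarrow> weakly_typeK_retrotone_on H T X"
  unfolding weakly_typeK_retrotone_on_def lessK_Compl by auto

lemma typeK_retrotone_on_Compl:
  "typeK_retrotone_on (- H) T X \<longleftrightarrow> typeK_retrotone_on H T X"
  unfolding typeK_retrotone_on_def lessK_Compl by auto

text \<open>
  Interpreting the locale at \<open>- H\<close> reverses \<open>\<le>\<^sub>K\<close> and exchanges the two faces, so results are only
  proved for \<open>face_V H\<close> and \<open>Sigma_V\<close>.
\<close>
locale typeK_system =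
  fixes H :: "'n::finite set"
    and f T :: "real^'n \<Rightarrow> real^'n"
    and r q :: "real^'n"
  assumes H_ne: "H \<noteq> {}" and V_ne: "- H \<noteq> {}"
    and C1: "C1_on orthant f"
    and f_pos: "x \<in> orthant \<Longrightarrow> f x $ i > 0"
    and T_def: "T = kolmogorov_map f"
    and competitive: "typeK_competitive H f"
    and f_0: "f 0 $ i > 1"
    and r_pos: "r \<in> open_orthant"
    and absorbing: "x \<in> orthant \<Longrightarrow> \<forall>\<^sub>F n in sequentially. (T ^^ n) x \<in> {0..r}"
    and T_box: "T ` {0..r} \<subseteq> half_open_box r"
    and T_inj: "inj_on T {0..r}"
    and q_pos: "vll 0 q"
    and f_q: "x \<in> {0..q} \<Longrightarrow> f x $ i > 1"
    and T_D: "T ` ({0..r} - half_open_box q) \<subseteq> {0..r} - half_open_box q"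
begin

abbreviation "L \<equiv> coord_sum H"
abbreviation "D \<equiv> {0..r} - half_open_box q"
abbreviation "\<Sigma> \<equiv> Sigma_set T r q"
abbreviation "S \<equiv> inv_into {0..r} T"

section \<open>Boxes, the map T, and a one-sided estimate for f\<close>

lemma orthant_iff: "x \<in> orthant \<longleftrightarrow> 0 \<le> x"
  by (simp add: orthant_def less_eq_vec_def)

lemma box_orthant: "x \<in> {0..r} \<Longrightarrow> x \<in> orthant"
  by (simp add: orthant_iff)

lemma box_iff: "x \<in> {0..r} \<longleftrightarrow> (\<forall>i. 0 \<le> x $ i \<and> x $ i \<le> r $ i)"
  by (auto simp: less_eq_vec_def)

lemma half_open_box_iff: "x \<in> half_open_box y \<longleftrightarrow> (\<forall>i. 0 \<le> x $ i \<and> x $ i < y $ i)"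
  by (auto simp: half_open_box_def vll_def open_orthant_def orthant_def)

lemma half_open_box_sub: "half_open_box y \<subseteq> {0..y}"
  by (auto simp: half_open_box_iff less_eq_vec_def less_imp_le)

lemma T_nth: "T x $ i = x $ i * f x $ i"
  by (simp add: T_def kolmogorov_map_def)

lemma T_nth_0_iff: "x \<in> orthant \<Longrightarrow> T x $ i = 0 \<longleftrightarrow> x $ i = 0"
  using f_pos[of x i] by (simp add: T_nth)

lemma T_orthant: "T ` orthant \<subseteq> orthant"
proof
  fix y assume "y \<in> T ` orthant"
  then obtain x where x: "x \<in> orthant" "y = T x" by blast
  then have "0 \<le> x $ i * f x $ i" for i
    using f_pos[of x i] by (simp add: orthant_def)
  then show "y \<in> orthant" by (simp add: x(2) orthant_def T_nth)
qed

lemma funpow_nth_0_iff: "x \<in> orthant \<Longrightarrow> (T ^^ n) x $ i = 0 \<longleftrightarrow> x $ i = 0"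
  by (induction n) (simp_all add: T_nth_0_iff funpow_mem[OF T_orthant])

lemma T_box_box: "T ` {0..r} \<subseteq> {0..r}"
  using T_box half_open_box_sub[of r] by blast

lemma cont_f: "continuous_on orthant f"
  using C1 by (simp add: C1_on_def differentiable_imp_continuous_on)

lemma cont_f_nth: "A \<subseteq> orthant \<Longrightarrow> continuous_on A (\<lambda>x. f x $ i)"
  by (intro continuous_intros continuous_on_subset[OF cont_f])

lemma cont_T: "continuous_on orthant T"
  unfolding T_def kolmogorov_map_def by (intro continuous_intros cont_f)

lemma box_sub: "{0..r} \<subseteq> orthant"
  using box_orthant by blast

lemma compact_box: "compact {0..r}"
  by (simp add: interval_cbox_cart)

lemma f_diff_ge:
  assumes "i \<in> H"
  obtains c where "c > 0"
    "\<And>x y. x \<in> {0..r} \<Longrightarrow> y \<in> {0..r} \<Longrightarrow> leK H x y \<Longrightarrow> c * (y $ i - x $ i) \<le> f x $ i - f y $ i"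
proof -
  define J where "J = (\<lambda>z. jacobian f (at z within orthant))"
  have comp: "(i \<in> H \<longleftrightarrow> j \<in> H) \<Longrightarrow> J z $ i $ j \<le> 0" "J z $ i $ i < 0"
    "\<not> (i \<in> H \<longleftrightarrow> j \<in> H) \<Longrightarrow> 0 \<le> J z $ i $ j" if "z \<in> orthant" for i j z
    using competitive that unfolding typeK_competitive_def J_def Let_def by blast+
  have contJ: "continuous_on {0..r} J"
    using C1 box_sub unfolding C1_on_def J_def by (blast intro: continuous_on_subset)
  have "r \<in> {0..r}" using r_pos by (simp add: open_orthant_def less_eq_vec_def less_imp_le)
  \<comment> \<open>The largest value of the diagonal entry over the compact box is still negative;
    its negative serves as a \<open>c\<close> that is uniform in \<open>x\<close> and
    \<open>y\<close>.\<close>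
  then obtain z0 where z0: "z0 \<in> {0..r}" "\<And>z. z \<in> {0..r} \<Longrightarrow> J z $ i $ i \<le> J z0 $ i $ i"
    using continuous_attains_sup[OF compact_box, of "\<lambda>z. J z $ i $ i"] continuous_on_component continuous_on_component[OF contJ]
    by blast
  define c where "c = - J z0 $ i $ i"
  show ?thesis
  proof (rule that[of c])
    show "c > 0" using comp(2)[OF box_orthant[OF z0(1)]] by (simp add: c_def)
    fix x y assume xy: "x \<in> {0..r}" "y \<in> {0..r}" and le: "leK H x y"
    define p where "p t = x + t *\<^sub>R (y - x)" for t :: real
    have p: "p t \<in> {0..r}" if "t \<in> {0..1}" for t
    proof -
      have "p t = (1 - t) *\<^sub>R x + t *\<^sub>R y" by (simp add: p_def algebra_simps)
      moreover have "convex {0..r}" by (simp add: interval_cbox_cart)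
      ultimately show ?thesis using convexD_alt[of "{0..r}" x y t] xy that by simp
    qed
    have der: "((\<lambda>t. f (p t) $ i) has_derivative (\<lambda>h. (J (p t) *v (h *\<^sub>R (y - x))) $ i)) (at t within {0..1})"
      if "t \<in> {0..1}" for t
    proof -
      have "(f has_derivative (\<lambda>h. J (p t) *v h)) (at (p t) within orthant)"
        using C1 p[OF that] box_orthant unfolding C1_on_def differentiable_on_def J_def
        by (blast intro: jacobian_works[THEN iffD1])
      \<comment> \<open>The derivative is only one within the orthant. The segment stays there, so
        the chain rule applies along it even on the boundary.\<close>
      then have "(f has_derivative (\<lambda>h. J (p t) *v h)) (at (p t) within p ` {0..1})"
        by (rule has_derivative_subset) (use p box_orthant in blast)
      moreover have "(p has_derivative (\<lambda>h. h *\<^sub>R (y - x))) (at t within {0..1})"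
        unfolding p_def by (auto intro!: derivative_eq_intros)
      ultimately have "(f \<circ> p has_derivative (\<lambda>h. J (p t) *v h) \<circ> (\<lambda>h. h *\<^sub>R (y - x))) (at t within {0..1})"
        by (intro diff_chain_within)
      from bounded_linear.has_derivative[OF bounded_linear_vec_nth this, of i]
      show ?thesis by (simp add: o_def)
    qed
    obtain t where t: "t \<in> {0..1}" "f (p 1) $ i - f (p 0) $ i = (J (p t) *v ((1 - 0) *\<^sub>R (y - x))) $ i"
      using mvt_very_simple[of 0 1 "\<lambda>t. f (p t) $ i" "\<lambda>t h. (J (p t) *v (h *\<^sub>R (y - x))) $ i"] der
      by auto
    have pt: "p t \<in> {0..r}" "p t \<in> orthant" using p[OF t(1)] box_orthant by auto
    have "f y $ i - f x $ i = (\<Sum>j\<in>UNIV. J (p t) $ i $ j * (y $ j - x $ j))"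
      using t(2) by (simp add: p_def matrix_vector_mult_def)
    \<comment> \<open>Off the diagonal, the entry and \<open>y $ j - x $ j\<close> have opposite
      weak signs, so those summands are bounded by 0.\<close>
    also have "\<dots> \<le> (\<Sum>j\<in>UNIV. if j = i then - c * (y $ i - x $ i) else 0)"
    proof (rule sum_mono)
      fix j
      show "J (p t) $ i $ j * (y $ j - x $ j) \<le> (if j = i then - c * (y $ i - x $ i) else 0)"
      proof (cases "j = i")
        case True
        then show ?thesis using z0(2)[OF pt(1)] le assms
          by (auto simp: c_def leK_iff intro!: mult_right_mono)
      next
        case False
        then show ?thesis using comp(1)[OF pt(2), of i j] comp(3)[OF pt(2), of i j] le assms
          by (cases "j \<in> H") (auto simp: leK_iff mult_nonpos_nonneg mult_nonneg_nonpos)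
      qed
    qed
    also have "\<dots> = - c * (y $ i - x $ i)" by simp
    finally show "c * (y $ i - x $ i) \<le> f x $ i - f y $ i" by simp
  qed
qed

section \<open>Growth of the H-coordinates near the face C_V\<close>

lemma L_nonneg: "x \<in> orthant \<Longrightarrow> L x \<ge> 0"
  unfolding coord_sum_def orthant_def by (simp add: sum_nonneg)

lemma L_eq_0_iff: "x \<in> orthant \<Longrightarrow> L x = 0 \<longleftrightarrow> x \<in> face_V H"
  unfolding coord_sum_def orthant_def face_V_def by (simp add: sum_nonneg_eq_0_iff)

lemma L_face_V: "x \<in> face_V H \<Longrightarrow> L x = 0"
  by (simp add: coord_sum_def face_V_def)

lemma L_pos: "x \<in> orthant \<Longrightarrow> x \<notin> face_V H \<Longrightarrow> L x > 0"
  using L_nonneg L_eq_0_iff by (metis less_eq_real_def)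

lemma cont_L: "continuous_on A L"
  unfolding coord_sum_def by (intro continuous_intros)

lemma face_V_funpow_iff: "x \<in> orthant \<Longrightarrow> (T ^^ n) x \<in> face_V H \<longleftrightarrow> x \<in> face_V H"
  by (simp add: face_V_def funpow_nth_0_iff funpow_mem[OF T_orthant])

lemma face_V_T_iff: "x \<in> orthant \<Longrightarrow> T x \<in> face_V H \<longleftrightarrow> x \<in> face_V H"
  using face_V_funpow_iff[of x 1] by simp

lemma f_face_V:
  assumes "x \<in> {0..r}" "x \<in> face_V H" "i \<in> H"
  shows "f x $ i > 1"
proof -
  obtain c where c: "\<And>x y. x \<in> {0..r} \<Longrightarrow> y \<in> {0..r} \<Longrightarrow> leK H x y \<Longrightarrow>
      c * (y $ i - x $ i) \<le> f x $ i - f y $ i"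
    using f_diff_ge[OF assms(3)] by metis
  have "0 \<in> {0..r}" using assms(1) by (auto intro: order_trans)
  moreover have "leK H x 0" using assms(2) by (simp add: leK_iff face_V_def orthant_def)
  ultimately have "c * (0 $ i - x $ i) \<le> f x $ i - f 0 $ i" using c assms(1) by blast
  moreover have "x $ i = 0" using assms(2,3) by (simp add: face_V_def)
  ultimately have "f 0 $ i \<le> f x $ i" by simp
  then show ?thesis using f_0[of i] by linarith
qed

text \<open>The first clause drives orbits out of the strip below \<epsilon>, the second keeps them
  from returning. Read backwards, a backward orbit that falls below \<epsilon> stays below and
  decays geometrically.\<close>

definition threshold :: "real \<Rightarrow> bool" where
  "threshold \<epsilon> \<longleftrightarrow> \<epsilon> > 0 \<and> (\<exists>c>1. \<forall>x\<in>{0..r}. L x \<le> \<epsilon> \<longrightarrow> c * L x \<le> L (T x)) \<and>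
     (\<forall>x\<in>{0..r}. \<epsilon> \<le> L x \<longrightarrow> \<epsilon> < L (T x))"

lemma thresholdD:
  assumes "threshold \<epsilon>"
  shows "\<epsilon> > 0" "x \<in> {0..r} \<Longrightarrow> \<epsilon> \<le> L x \<Longrightarrow> \<epsilon> < L (T x)"
  using assms unfolding threshold_def by blast+

lemma closed_face_V: "closed (face_V H)"
proof -
  have "face_V H = (\<Inter>i. {x. 0 \<le> x $ i}) \<inter> (\<Inter>i\<in>H. {x. x $ i = 0})"
    by (auto simp: face_V_def orthant_def)
  then show ?thesis
    by (auto intro!: closed_Int closed_INT closed_Collect_eq closed_Collect_le continuous_intros)
qed

text \<open>On the compact part of the face in the box all \<open>f x $ i\<close> with
  \<open>i\<close> in \<open>H\<close> exceed 1 uniformly, and by compactness this persists for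
  small \<open>L x\<close>. For larger \<open>L x\<close> the value \<open>L (T x)\<close> is
  bounded away from 0, since \<open>T\<close> maps no point outside the face into it.\<close>

lemma threshold_exists: "\<exists>\<epsilon>. threshold \<epsilon>"
proof -
  \<comment> \<open>An empty \<open>A\<close> has no minimum; the bound 1 is used for it.\<close>
  have pos_min: "\<exists>e>0. \<forall>x\<in>A. e \<le> g x"
    if "compact A" "continuous_on A g" "\<forall>x\<in>A. g x > 0" for A and g :: "real^'n \<Rightarrow> real"
  proof (cases "A = {}")
    case True
    then show ?thesis using zero_less_one by blast
  next
    case False
    then show ?thesis using continuous_attains_inf[OF that(1) _ that(2)] that(3) by blast
  qed
  have compact_face: "compact ({0..r} \<inter> face_V H)"
    by (intro compact_Int_closed compact_box closed_face_V)
  have "\<forall>i\<in>H. \<exists>e>0. \<forall>x\<in>{0..r} \<inter> face_V H. e \<le> f x $ i - 1"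
  proof
    fix i assume "i \<in> H"
    show "\<exists>e>0. \<forall>x\<in>{0..r} \<inter> face_V H. e \<le> f x $ i - 1"
    proof (rule pos_min[OF compact_face])
      show "continuous_on ({0..r} \<inter> face_V H) (\<lambda>x. f x $ i - 1)"
        using box_sub by (intro continuous_intros cont_f_nth) blast
      show "\<forall>x\<in>{0..r} \<inter> face_V H. 0 < f x $ i - 1"
      proof
        fix x assume "x \<in> {0..r} \<inter> face_V H"
        then have "1 < f x $ i" using f_face_V \<open>i \<in> H\<close> by blast
        then show "0 < f x $ i - 1" by simp
      qed
    qed
  qed
  from bchoice[OF this] obtain e where e: "\<And>i. i \<in> H \<Longrightarrow> e i > 0"
    "\<And>i x. i \<in> H \<Longrightarrow> x \<in> {0..r} \<inter> face_V H \<Longrightarrow> e i \<le> f x $ i - 1" by blast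
  \<comment> \<open>Half of the least excess over 1 is taken, so that \<open>f x $ i > c\<close>
    holds strictly on the face.\<close>
  define c where "c = 1 + Min (e ` H) / 2"
  have Min: "Min (e ` H) > 0" "\<And>i. i \<in> H \<Longrightarrow> Min (e ` H) \<le> e i"
    using e(1) H_ne by auto
  have c1: "c > 1" using Min(1) by (simp add: c_def)
  have face_c: "f x $ i > c" if "x \<in> {0..r} \<inter> face_V H" "i \<in> H" for x i
    using e(2)[OF that(2,1)] Min(1) Min(2)[OF that(2)] unfolding c_def by argo
  \<comment> \<open>\<open>Z\<close> collects the points where growth by the factor \<open>c\<close>
    may fail. It is compact and misses the face, so \<open>L\<close> has a positive lower bound
    \<open>e1\<close> on it.\<close>
  define Z where "Z = {x \<in> {0..r}. \<exists>i\<in>H. f x $ i \<le> c}"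
  have "Z = (\<Union>i\<in>H. {x \<in> {0..r}. f x $ i \<le> c})" by (auto simp: Z_def)
  moreover have "compact {x \<in> {0..r}. f x $ i \<le> c}" for i
  proof -
    have "closed ({0..r} \<inter> (\<lambda>x. f x $ i) -` {..c})"
      by (intro continuous_closed_preimage cont_f_nth box_sub compact_imp_closed compact_box closed_atMost)
    moreover have "{0..r} \<inter> (\<lambda>x. f x $ i) -` {..c} = {x \<in> {0..r}. f x $ i \<le> c}" by blast
    ultimately show ?thesis using compact_Int_closed[OF compact_box] by (metis Int_left_absorb)
  qed
  ultimately have "compact Z" by auto
  moreover have "\<forall>x\<in>Z. L x > 0"
  proof
    fix x assume "x \<in> Z"
    then have "x \<in> orthant" "x \<notin> face_V H" using face_c box_orthant unfolding Z_def by fastforce+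
    then show "L x > 0" by (rule L_pos)
  qed
  ultimately obtain e1 where e1: "e1 > 0" "\<And>x. x \<in> Z \<Longrightarrow> e1 \<le> L x"
    using pos_min[of Z L] cont_L by blast
  have grow: "L (T x) \<ge> c * L x" if "x \<in> {0..r}" "L x < e1" for x
  proof -
    have "c * x $ i \<le> T x $ i" if "i \<in> H" for i
    proof -
      have "x \<notin> Z" using e1(2)[of x] \<open>L x < e1\<close> by linarith
      then have "c \<le> f x $ i" using that \<open>x \<in> {0..r}\<close> unfolding Z_def by force
      moreover have "0 \<le> x $ i" using \<open>x \<in> {0..r}\<close> unfolding box_iff by blast
      ultimately show ?thesis unfolding T_nth mult.commute[of "x $ i"] by (rule mult_right_mono)
    qed
    then show ?thesis unfolding coord_sum_def sum_distrib_left by (rule sum_mono)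
  qed
  define A where "A = {0..r} \<inter> {x. e1 \<le> L x}"
  have A: "compact A" unfolding A_def
    by (intro compact_Int_closed compact_box closed_Collect_le continuous_intros cont_L)
  have LT: "continuous_on A (\<lambda>x. L (T x))"
    unfolding coord_sum_def A_def using box_sub
    by (intro continuous_intros continuous_on_subset[OF cont_T]) blast
  have "\<forall>x\<in>A. L (T x) > 0"
  proof
    fix x assume x: "x \<in> A"
    then have "x \<in> orthant" "e1 \<le> L x" using box_orthant unfolding A_def by blast+
    then have "x \<in> orthant" "x \<notin> face_V H" using L_eq_0_iff[of x] e1(1) by auto
    then show "L (T x) > 0" using L_pos[of "T x"] face_V_T_iff T_orthant by blast
  qed
  from pos_min[OF A LT this] obtain m where m: "m > 0" "\<And>x. x \<in> A \<Longrightarrow> m \<le> L (T x)"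
    by blast
  \<comment> \<open>Below \<open>e1\<close> the growth estimate applies, from \<open>e1\<close> on
    the bound \<open>m\<close>; halving makes \<epsilon> strictly smaller than both.\<close>
  define \<epsilon> where "\<epsilon> = min e1 m / 2"
  have \<epsilon>: "\<epsilon> > 0" "\<epsilon> < e1" "\<epsilon> < m" using e1(1) m(1) by (auto simp: \<epsilon>_def)
  have "\<epsilon> < L (T x)" if "x \<in> {0..r}" "\<epsilon> \<le> L x" for x
  proof (cases "L x < e1")
    case True
    have "\<epsilon> < c * \<epsilon>" using c1 \<epsilon>(1) by simp
    also have "\<dots> \<le> c * L x" using c1 that by (intro mult_left_mono) auto
    also have "\<dots> \<le> L (T x)" using grow True that by blast
    finally show ?thesis .
  next
    case False
    then show ?thesis using m(2)[of x] that \<epsilon>(3) by (simp add: A_def)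
  qed
  moreover have "c * L x \<le> L (T x)" if "x \<in> {0..r}" "L x \<le> \<epsilon>" for x
    using grow that \<epsilon>(2) by simp
  ultimately show ?thesis unfolding threshold_def using \<epsilon>(1) c1 by blast
qed

section \<open>Absorption into D and the scheme for attractors\<close>

lemma D_iff: "x \<in> D \<longleftrightarrow> x \<in> {0..r} \<and> (\<exists>i. q $ i \<le> x $ i)"
  unfolding Diff_iff half_open_box_iff box_iff by (auto simp: not_less)

lemma compact_D: "compact D"
proof -
  have "D = {0..r} \<inter> (\<Union>i. {x. q $ i \<le> x $ i})" using D_iff by blast
  then show ?thesis
    by (auto intro!: compact_Int_closed compact_box closed_UN closed_Collect_le continuous_intros
        simp del: atLeastAtMost_iff)
qed

lemma q_nth_pos: "0 < q $ i"
  using q_pos by (simp add: vll_def open_orthant_def)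

lemma zero_notin_D: "0 \<notin> D"
  using q_nth_pos by (simp only: D_iff zero_index not_le) (auto simp: not_le)

text \<open>A coordinate that is positive at the start stays positive. While the orbit remains in
  \<open>{0..q}\<close>, it is multiplied at each step by at least the minimum of \<open>f\<close>
  in that coordinate, which exceeds 1; so the orbit must leave \<open>{0..q}\<close>.\<close>

lemma reach_D:
  assumes "x \<in> orthant" "x \<noteq> 0"
  obtains n W where "open W" "(T ^^ n) x \<in> W" "W \<inter> orthant \<subseteq> D"
proof -
  obtain N where "(T ^^ N) x \<in> {0..r}"
    using absorbing[OF assms(1)] eventually_happens'[OF sequentially_bot] by blast
  \<comment> \<open>One further step lands strictly below \<open>r\<close> in every coordinate,
    which leaves room for the open set \<open>W\<close>.\<close>
  then have yr: "(T ^^ Suc N) x \<in> half_open_box r" using T_box by auto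
  define y where "y = (T ^^ Suc N) x"
  have yo: "y \<in> orthant" unfolding y_def by (rule funpow_mem[OF T_orthant assms(1)])
  have T_hob: "T ` half_open_box r \<subseteq> half_open_box r"
    using T_box half_open_box_sub by blast
  obtain i where "x $ i \<noteq> 0" using assms(2) by (auto simp: vec_eq_iff)
  then have yi: "y $ i > 0"
    using funpow_nth_0_iff[OF assms(1), of "Suc N" i] yo unfolding y_def orthant_def
    by (simp add: order_less_le)
  have "\<exists>n j. q $ j < (T ^^ n) y $ j"
  proof (rule ccontr)
    assume contra: "\<not> ?thesis"
    have mem: "(T ^^ n) y \<in> {0..q}" for n
      using contra funpow_mem[OF T_orthant yo, of n]
      by (simp add: less_eq_vec_def orthant_def not_less)
    have "{0..q} \<subseteq> orthant" by (auto simp: orthant_iff)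
    moreover have "{0..q} \<noteq> {}" using mem by blast
    moreover have "compact {0..q}" by (simp add: interval_cbox_cart)
    ultimately obtain z where z: "z \<in> {0..q}" "\<And>w. w \<in> {0..q} \<Longrightarrow> f z $ i \<le> f w $ i"
      using continuous_attains_inf[OF _ _ cont_f_nth, of "{0..q}" i] by metis
    obtain n where "(T ^^ n) y $ i > q $ i"
    proof (rule geometric_growth_unbounded[of "\<lambda>n. (T ^^ n) y $ i" "f z $ i" "q $ i"])
      show "f z $ i * (T ^^ n) y $ i \<le> (T ^^ Suc n) y $ i" for n
      proof -
        have "f z $ i \<le> f ((T ^^ n) y) $ i" by (intro z(2) mem)
        moreover have "0 \<le> (T ^^ n) y $ i" using mem[of n] by (simp add: less_eq_vec_def)
        ultimately show ?thesis by (simp add: T_nth mult.commute[of "(T ^^ n) y $ i"] mult_right_mono)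
      qed
    qed (use yi f_q[OF z(1)] in auto)
    with contra show False by blast
  qed
  then obtain n j where nj: "q $ j < (T ^^ n) y $ j" by blast
  define W where "W = (\<Inter>k. {z. z $ k < r $ k}) \<inter> {z. q $ j < z $ j}"
  have "open W"
    unfolding W_def by (intro open_Int open_INT ballI open_Collect_less continuous_intros) auto
  moreover have "(T ^^ (n + Suc N)) x \<in> W"
    using nj funpow_mem[OF T_hob, of y n] yr
    unfolding W_def funpow_add comp_apply y_def[symmetric] by (simp add: half_open_box_iff)
  moreover have "W \<inter> orthant \<subseteq> D"
  proof
    fix z assume "z \<in> W \<inter> orthant"
    then have "\<And>k. 0 \<le> z $ k \<and> z $ k \<le> r $ k" "q $ j \<le> z $ j"
      by (auto simp: W_def orthant_def less_imp_le)
    then show "z \<in> D" unfolding D_iff box_iff by blast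
  qed
  ultimately show ?thesis by (rule that)
qed

text \<open>Common source of all attractors here: \<open>C\<close> is the whole space for \<Sigma>,
  the face itself for the face, and the set above both thresholds for \<open>Sigma_0\<close>. The
  hypothesis \<open>reach\<close> speaks of all late times because the time of entry into
  \<open>D\<close> cannot be prescribed.\<close>

lemma attractor:
  assumes Y: "Y \<subseteq> orthant - {0}" "T ` Y \<subseteq> Y" "Y \<noteq> {}"
    and C: "closed C" "T ` ({0..r} \<inter> C) \<subseteq> C" "D \<inter> C \<subseteq> Y"
    and reach: "\<And>x. x \<in> Y \<Longrightarrow> \<exists>N. \<forall>n\<ge>N. \<exists>W. open W \<and> (T ^^ n) x \<in> W \<and> W \<inter> Y \<subseteq> C"
  shows "global_attractor_on T Y (\<Inter>n. (T ^^ n) ` (D \<inter> C))"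
proof -
  have reach': "\<exists>n W. open W \<and> (T ^^ n) x \<in> W \<and> W \<inter> Y \<subseteq> D \<inter> C" if x: "x \<in> Y" for x
  proof -
    obtain N where N: "\<forall>n\<ge>N. \<exists>W. open W \<and> (T ^^ n) x \<in> W \<and> W \<inter> Y \<subseteq> C" using reach[OF x] ..
    \<comment> \<open>Starting \<open>reach_D\<close> at time \<open>N\<close> yields a time
      \<open>n + N\<close> that is also late enough for \<open>C\<close>.\<close>
    have "(T ^^ N) x \<in> orthant" "(T ^^ N) x \<noteq> 0" using funpow_mem[OF Y(2) x, of N] Y(1) by auto
    then obtain n W where W: "open W" "(T ^^ n) ((T ^^ N) x) \<in> W" "W \<inter> orthant \<subseteq> D"
      by (rule reach_D)
    obtain W' where W': "open W'" "(T ^^ (n + N)) x \<in> W'" "W' \<inter> Y \<subseteq> C"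
      using N le_add2[of N n] by blast
    have "(W \<inter> W') \<inter> Y \<subseteq> D \<inter> C" using W(3) W'(3) Y(1) by blast
    moreover have "(T ^^ (n + N)) x \<in> W \<inter> W'" using W(2) W'(2) by (simp add: funpow_add)
    ultimately show ?thesis using open_Int[OF W(1) W'(1)] by blast
  qed
  show ?thesis
  proof (rule global_attractor_on_Inter[OF _ Y(2)])
    show "continuous_on Y T" using cont_T Y(1) by (blast intro: continuous_on_subset)
    show "compact (D \<inter> C)" by (intro compact_Int_closed compact_D C)
    show "T ` (D \<inter> C) \<subseteq> D \<inter> C" using T_D C(2) by blast
    show "inj_on T (D \<inter> C)" by (rule inj_on_subset[OF T_inj]) blast
    show "D \<inter> C \<noteq> {}"
    proof -
      obtain x where x: "x \<in> Y" using Y(3) by blast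
      then obtain n W where "(T ^^ n) x \<in> W" "W \<inter> Y \<subseteq> D \<inter> C" using reach' by blast
      then show ?thesis using funpow_mem[OF Y(2) x, of n] by blast
    qed
  qed (use C(3) reach' in auto)
qed


section \<open>The set \<Sigma> and its backward orbits\<close>

lemma Sigma_eq: "\<Sigma> = (\<Inter>n. (T ^^ n) ` D)"
  by (simp add: Sigma_set_def)

text \<open>Compactness and invariance of \<Sigma>, used throughout, are read off from this instance
  of the scheme.\<close>

lemma Sigma_attractor: "global_attractor_on T (orthant - {0}) \<Sigma>"
proof -
  have "T ` (orthant - {0}) \<subseteq> orthant - {0}"
    using T_orthant T_nth_0_iff by (auto simp: vec_eq_iff)
  moreover have "r \<in> orthant - {0}" using r_pos by (auto simp: open_orthant_def orthant_def less_imp_le)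
  moreover have "D \<subseteq> orthant - {0}" using box_orthant zero_notin_D by blast
  ultimately have "global_attractor_on T (orthant - {0}) (\<Inter>n. (T ^^ n) ` (D \<inter> UNIV))"
    by (intro attractor) (auto intro!: exI[of _ UNIV] simp del: atLeastAtMost_iff Diff_iff)
  then show ?thesis by (simp only: Int_UNIV_right Sigma_eq)
qed

lemma Sigma_D: "\<Sigma> \<subseteq> D"
proof -
  have "\<Sigma> \<subseteq> (T ^^ 0) ` D" unfolding Sigma_eq by (rule INT_lower) simp
  then show ?thesis by (simp only: funpow.simps(1) id_def image_ident)
qed

lemma Sigma_box: "x \<in> \<Sigma> \<Longrightarrow> x \<in> {0..r}"
  using Sigma_D by blast

lemma compact_Sigma: "compact \<Sigma>" and T_Sigma: "T ` \<Sigma> = \<Sigma>"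
  using Sigma_attractor by (auto simp: global_attractor_on_def)

lemma S_T: "x \<in> {0..r} \<Longrightarrow> S (T x) = x"
  by (rule inv_into_f_f[OF T_inj])

lemma S_funpow: "x \<in> {0..r} \<Longrightarrow> (S ^^ n) ((T ^^ n) x) = x"
proof (induction n)
  case (Suc n)
  have "(S ^^ Suc n) ((T ^^ Suc n) x) = (S ^^ n) (S (T ((T ^^ n) x)))"
    by (simp add: funpow_swap1)
  also have "\<dots> = (S ^^ n) ((T ^^ n) x)"
    using S_T[OF funpow_mem[OF T_box_box Suc.prems]] by simp
  finally show ?case using Suc by simp
qed simp

text \<open>Invariance provides a preimage in \<Sigma>, and injectivity on the box identifies it
  with the value of \<open>S\<close>.\<close>

lemma S_Sigma: "S ` \<Sigma> \<subseteq> \<Sigma>" and T_S: "x \<in> \<Sigma> \<Longrightarrow> T (S x) = x"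
proof -
  have *: "S x \<in> \<Sigma> \<and> T (S x) = x" if x: "x \<in> \<Sigma>" for x
  proof -
    obtain y where y: "y \<in> \<Sigma>" "x = T y" using x T_Sigma by blast
    then show ?thesis using S_T[OF Sigma_box[OF y(1)]] by simp
  qed
  show "S ` \<Sigma> \<subseteq> \<Sigma>" using * by blast
  show "x \<in> \<Sigma> \<Longrightarrow> T (S x) = x" using * by blast
qed

lemma S_funpow_Sigma: "x \<in> \<Sigma> \<Longrightarrow> (S ^^ n) x \<in> \<Sigma>"
  by (rule funpow_mem[OF S_Sigma])

lemma T_S_funpow_Suc: "x \<in> \<Sigma> \<Longrightarrow> T ((S ^^ Suc n) x) = (S ^^ n) x"
  using T_S[OF S_funpow_Sigma] by simp

lemma T_funpow_S_funpow: "x \<in> \<Sigma> \<Longrightarrow> (T ^^ n) ((S ^^ n) x) = x"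
proof (induction n)
  case (Suc n)
  have "(T ^^ Suc n) ((S ^^ Suc n) x) = (T ^^ n) (T ((S ^^ Suc n) x))"
    by (simp add: funpow_swap1)
  then show ?case using Suc T_S_funpow_Suc[OF Suc.prems, of n] by simp
qed simp

text \<open>This describes attractors by backward orbits: \<open>(T ^^ n) d\<close> has
  \<open>d\<close> as its \<open>n\<close>-th backward iterate, and backward iterates of points of
  \<Sigma> remain in \<open>D\<close>.\<close>

lemma Inter_D_Int:
  assumes inv: "\<And>x. x \<in> {0..r} \<Longrightarrow> x \<in> C \<Longrightarrow> T x \<in> C"
  shows "(\<Inter>n. (T ^^ n) ` (D \<inter> C)) = {x \<in> \<Sigma>. \<forall>n. (S ^^ n) x \<in> C}"
proof (rule equalityI)
  show "{x \<in> \<Sigma>. \<forall>n. (S ^^ n) x \<in> C} \<subseteq> (\<Inter>n. (T ^^ n) ` (D \<inter> C))"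
  proof (intro subsetI INT_I)
    fix x n assume x: "x \<in> {x \<in> \<Sigma>. \<forall>n. (S ^^ n) x \<in> C}"
    then have "(S ^^ n) x \<in> D \<inter> C" using S_funpow_Sigma Sigma_D by blast
    moreover have "x = (T ^^ n) ((S ^^ n) x)" using T_funpow_S_funpow x by simp
    ultimately show "x \<in> (T ^^ n) ` (D \<inter> C)" by (rule rev_image_eqI)
  qed
  show "(\<Inter>n. (T ^^ n) ` (D \<inter> C)) \<subseteq> {x \<in> \<Sigma>. \<forall>n. (S ^^ n) x \<in> C}"
  proof
    fix x assume x: "x \<in> (\<Inter>n. (T ^^ n) ` (D \<inter> C))"
    then have "x \<in> \<Sigma>" unfolding Sigma_eq by blast
    moreover have "(S ^^ n) x \<in> C" for n
    proof -
      obtain d where d: "d \<in> D" "d \<in> C" "x = (T ^^ n) d" using x by blast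
      then show ?thesis using S_funpow[of d n] by simp
    qed
    ultimately show "x \<in> {x \<in> \<Sigma>. \<forall>n. (S ^^ n) x \<in> C}" by blast
  qed
qed

lemma S_funpow_face_V_iff:
  assumes "x \<in> \<Sigma>"
  shows "(S ^^ n) x \<in> face_V H \<longleftrightarrow> x \<in> face_V H"
  using face_V_funpow_iff[of "(S ^^ n) x" n] box_orthant[OF Sigma_box[OF S_funpow_Sigma[OF assms, of n]]]
    T_funpow_S_funpow[OF assms, of n] by simp

text \<open>Zero coordinates are preserved by \<open>T\<close> in both directions of time, so a
  backward orbit lies in the face exactly when its starting point does.\<close>

lemma face_V_attractor: "global_attractor_on T (face_V H - {0}) (\<Sigma> \<inter> face_V H)"
proof -
  have sub: "face_V H \<subseteq> orthant" by (auto simp: face_V_def)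
  have inv: "T x \<in> face_V H" if "x \<in> face_V H" for x using that face_V_T_iff sub by blast
  obtain j where j: "j \<notin> H" using V_ne by blast
  have "axis j 1 \<in> face_V H" using j by (auto simp: face_V_def orthant_def axis_def)
  moreover have "axis j (1::real) \<noteq> 0" by (simp add: axis_eq_0_iff)
  ultimately have ne: "face_V H - {0} \<noteq> {}" by blast
  have "T ` (orthant - {0}) \<subseteq> orthant - {0}"
    using Sigma_attractor unfolding global_attractor_on_def by (rule conjunct1)
  then have T_face: "T ` (face_V H - {0}) \<subseteq> face_V H - {0}" using inv sub by blast
  have "global_attractor_on T (face_V H - {0}) (\<Inter>n. (T ^^ n) ` (D \<inter> face_V H))"
  proof (rule attractor[OF _ T_face ne closed_face_V])
    show "face_V H - {0} \<subseteq> orthant - {0}" using sub by blast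
    show "T ` ({0..r} \<inter> face_V H) \<subseteq> face_V H" using inv by blast
    show "D \<inter> face_V H \<subseteq> face_V H - {0}" using zero_notin_D by blast
    show "\<exists>N. \<forall>n\<ge>N. \<exists>W. open W \<and> (T ^^ n) x \<in> W \<and> W \<inter> (face_V H - {0}) \<subseteq> face_V H" for x
      using open_UNIV by blast
  qed
  moreover have "(\<Inter>n. (T ^^ n) ` (D \<inter> face_V H)) = \<Sigma> \<inter> face_V H"
    using Inter_D_Int[of "face_V H"] inv S_funpow_face_V_iff by blast
  ultimately show ?thesis by simp
qed

section \<open>Limit sets of backward orbits and the repelling face\<close>

lemma alpha_limit_subset:
  assumes "closed A" "\<And>m. m \<ge> n \<Longrightarrow> (S ^^ m) x \<in> A"
  shows "alpha_limit T r x \<subseteq> A"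
proof -
  have "alpha_limit T r x \<subseteq> closure {(S ^^ m) x |m. m \<ge> n}" unfolding alpha_limit_def by blast
  also have "\<dots> \<subseteq> A" using assms by (intro closure_minimal) auto
  finally show ?thesis .
qed

lemma alpha_limit_Sigma: "x \<in> \<Sigma> \<Longrightarrow> alpha_limit T r x \<subseteq> \<Sigma>"
  by (rule alpha_limit_subset[OF compact_imp_closed[OF compact_Sigma] S_funpow_Sigma])

text \<open>Tails of the backward orbit lie in the compact set \<Sigma>, so their closures are
  nested nonempty compact sets.\<close>

lemma alpha_limit_nonempty:
  assumes "x \<in> \<Sigma>"
  shows "alpha_limit T r x \<noteq> {}"
  unfolding alpha_limit_def
proof (rule compact_nest)
  fix n
  have "{(S ^^ m) x |m. m \<ge> n} \<subseteq> \<Sigma>" using S_funpow_Sigma[OF assms] by blast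
  then have "bounded {(S ^^ m) x |m. m \<ge> n}"
    using compact_imp_bounded[OF compact_Sigma] by (rule bounded_subset[rotated])
  then show "compact (closure {(S ^^ m) x |m. m \<ge> n})" by simp
  show "closure {(S ^^ m) x |m. m \<ge> n} \<noteq> {}" by (simp add: closure_eq_empty) blast
next
  fix m n :: nat assume "m \<le> n"
  then have "{(S ^^ k) x |k. k \<ge> n} \<subseteq> {(S ^^ k) x |k. k \<ge> m}" by (auto intro: order_trans)
  then show "closure {(S ^^ k) x |k. k \<ge> n} \<subseteq> closure {(S ^^ k) x |k. k \<ge> m}" by (rule closure_mono)
qed

lemma Sigma_V_face_V: "Sigma_V H T r q \<inter> face_V H = \<Sigma> \<inter> face_V H"
proof -
  have "alpha_limit T r x \<subseteq> \<Sigma> \<inter> face_V H" if "x \<in> \<Sigma> \<inter> face_V H" for x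
  proof (rule alpha_limit_subset[of _ 0])
    show "closed (\<Sigma> \<inter> face_V H)" by (intro closed_Int compact_imp_closed compact_Sigma closed_face_V)
  qed (use that S_funpow_Sigma S_funpow_face_V_iff in blast)
  then show ?thesis unfolding Sigma_V_def by blast
qed

lemma threshold_funpow:
  assumes "threshold \<epsilon>" "x \<in> {0..r}" "\<epsilon> < L x"
  shows "\<epsilon> < L ((T ^^ n) x)"
proof (induction n)
  case (Suc n)
  then show ?case
    using thresholdD(2)[OF assms(1) funpow_mem[OF T_box_box assms(2), of n]] by simp
qed (use assms in simp)

text \<open>Once in the box, \<open>L\<close> is positive along the orbit. If it never exceeded
  \<epsilon>, it would grow geometrically without bound; after exceeding \<epsilon> it stays
  above.\<close>

lemma eventually_above_threshold:
  assumes "threshold \<epsilon>" "x \<in> orthant" "x \<notin> face_V H"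
  obtains N where "\<And>n. n \<ge> N \<Longrightarrow> \<epsilon> < L ((T ^^ n) x)"
proof -
  obtain N where N: "(T ^^ N) x \<in> {0..r}"
    using absorbing[OF assms(2)] eventually_happens'[OF sequentially_bot] by blast
  define y where "y = (T ^^ N) x"
  have y: "y \<in> {0..r}" "L y > 0"
    using N L_pos[OF box_orthant[OF N]] face_V_funpow_iff assms(2,3) by (auto simp: y_def simp del: atLeastAtMost_iff)
  have "\<exists>n. \<epsilon> < L ((T ^^ n) y)"
  proof (rule ccontr)
    assume contra: "\<not> ?thesis"
    obtain c where c: "c > 1" "\<forall>x\<in>{0..r}. L x \<le> \<epsilon> \<longrightarrow> c * L x \<le> L (T x)"
      using assms(1) unfolding threshold_def by blast
    obtain n where "L ((T ^^ n) y) > \<epsilon>"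
    proof (rule geometric_growth_unbounded[of "\<lambda>n. L ((T ^^ n) y)" c \<epsilon>])
      show "c * L ((T ^^ n) y) \<le> L ((T ^^ Suc n) y)" for n
        using c(2) contra funpow_mem[OF T_box_box y(1), of n] by (simp del: atLeastAtMost_iff add: not_less)
    qed (use y c in auto)
    with contra show False by blast
  qed
  then obtain n where n: "\<epsilon> < L ((T ^^ n) y)" ..
  have "\<epsilon> < L ((T ^^ m) x)" if m: "m \<ge> n + N" for m
  proof -
    have "(T ^^ m) x = (T ^^ (m - (n + N))) ((T ^^ n) y)"
      using funpow_diff_apply(1)[OF m, of T x] by (simp add: y_def funpow_add)
    then show ?thesis
      using threshold_funpow[OF assms(1) funpow_mem[OF T_box_box y(1)] n] by simp
  qed
  then show ?thesis by (rule that)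
qed

lemma face_V_repeller: "repeller_on T \<Sigma> (\<Sigma> \<inter> face_V H)"
proof -
  obtain \<epsilon> where \<epsilon>: "threshold \<epsilon>" using threshold_exists ..
  define U where "U = \<Sigma> \<inter> {x. L x < \<epsilon>}"
  have "openin (top_of_set \<Sigma>) U"
    unfolding U_def by (intro openin_open_Int open_Collect_less continuous_intros cont_L)
  moreover have "\<Sigma> \<inter> face_V H \<subseteq> U"
    using L_face_V thresholdD(1)[OF \<epsilon>] unfolding U_def by auto
  moreover have "\<exists>n0. \<forall>n\<ge>n0. (T ^^ n) x \<notin> U" if "x \<in> U - \<Sigma> \<inter> face_V H" for x
  proof -
    have "x \<in> orthant" "x \<notin> face_V H" using that box_orthant[OF Sigma_box] by (auto simp: U_def)
    then obtain N where "\<And>n. n \<ge> N \<Longrightarrow> \<epsilon> < L ((T ^^ n) x)"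
      using eventually_above_threshold[OF \<epsilon>] by blast
    then show ?thesis by (intro exI[of _ N]) (force simp: U_def)
  qed
  moreover have "U \<subseteq> \<Sigma>" by (simp add: U_def)
  ultimately have "\<exists>U\<subseteq>\<Sigma>. (\<exists>W. openin (top_of_set \<Sigma>) W \<and> \<Sigma> \<inter> face_V H \<subseteq> W \<and> W \<subseteq> U) \<and>
      (\<forall>x\<in>U - \<Sigma> \<inter> face_V H. \<exists>n0. \<forall>n\<ge>n0. (T ^^ n) x \<notin> U)"
    by (intro exI[of _ U] conjI ballI) auto
  then show ?thesis
    using face_V_attractor unfolding repeller_on_def global_attractor_on_def by simp
qed

text \<open>The condition on a limit set is reduced to one moment of the backward orbit. Without
  such a moment the nonempty limit set has \<open>L\<close> at least \<epsilon> and misses the face;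
  after such a moment forward growth is backward decay, and \<open>L\<close> vanishes on the limit
  set.\<close>

lemma Sigma_V_iff:
  assumes \<epsilon>: "threshold \<epsilon>" and x: "x \<in> \<Sigma>"
  shows "x \<in> Sigma_V H T r q \<longleftrightarrow> (\<exists>m. L ((S ^^ m) x) < \<epsilon>)"
proof
  assume "x \<in> Sigma_V H T r q"
  then have alpha: "alpha_limit T r x \<subseteq> \<Sigma> \<inter> face_V H" by (simp add: Sigma_V_def)
  show "\<exists>m. L ((S ^^ m) x) < \<epsilon>"
  proof (rule ccontr)
    assume "\<not> ?thesis"
    then have "alpha_limit T r x \<subseteq> {z. \<epsilon> \<le> L z}"
      by (intro alpha_limit_subset[of _ 0] closed_Collect_le continuous_intros cont_L) (auto simp: not_less)
    moreover obtain z where "z \<in> alpha_limit T r x" using alpha_limit_nonempty[OF x] by blast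
    ultimately have z: "z \<in> \<Sigma>" "z \<in> face_V H" "\<epsilon> \<le> L z" using alpha by auto
    then show False using L_face_V thresholdD(1)[OF \<epsilon>] by simp
  qed
next
  assume "\<exists>m. L ((S ^^ m) x) < \<epsilon>"
  then obtain m where m: "L ((S ^^ m) x) < \<epsilon>" ..
  obtain c where c: "c > 1" "\<forall>x\<in>{0..r}. L x \<le> \<epsilon> \<longrightarrow> c * L x \<le> L (T x)"
    using \<epsilon> unfolding threshold_def by blast
  have step: "L ((S ^^ Suc n) x) < \<epsilon> \<and> c * L ((S ^^ Suc n) x) \<le> L ((S ^^ n) x)"
    if "L ((S ^^ n) x) < \<epsilon>" for n
  proof -
    have box: "(S ^^ Suc n) x \<in> {0..r}" by (rule Sigma_box[OF S_funpow_Sigma[OF x]])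
    have "L ((S ^^ Suc n) x) < \<epsilon>"
      using thresholdD(2)[OF \<epsilon> box] that unfolding T_S_funpow_Suc[OF x] by force
    then show ?thesis using c(2) box T_S_funpow_Suc[OF x, of n] by force
  qed
  have small: "L ((S ^^ (m + n)) x) < \<epsilon> \<and> c ^ n * L ((S ^^ (m + n)) x) \<le> \<epsilon>" for n
  proof (induction n)
    case (Suc n)
    have "c ^ Suc n * L ((S ^^ (m + Suc n)) x) = c ^ n * (c * L ((S ^^ Suc (m + n)) x))" by simp
    also have "\<dots> \<le> c ^ n * L ((S ^^ (m + n)) x)"
      using step Suc c(1) by (intro mult_left_mono) auto
    finally show ?case using step[of "m + n"] Suc by simp
  qed (use m in simp)
  have "L z = 0" if z: "z \<in> alpha_limit T r x" for z
  proof (rule antisym)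
    have "z \<in> \<Sigma>" using alpha_limit_Sigma[OF x] z by blast
    then show "0 \<le> L z" by (intro L_nonneg box_orthant Sigma_box)
    have lim: "(\<lambda>n. \<epsilon> * (1 / c) ^ n) \<longlonglongrightarrow> \<epsilon> * 0"
      using c(1) by (intro tendsto_mult tendsto_const LIMSEQ_power_zero) auto
    \<comment> \<open>For fixed \<open>n\<close> the bound holds on the whole tail from
      \<open>m + n\<close> on, hence on the limit set; only then does \<open>n\<close> tend to
      infinity.\<close>
    have "L z \<le> \<epsilon> * (1 / c) ^ n" for n
    proof -
      have "L ((S ^^ k) x) \<le> \<epsilon> * (1 / c) ^ n" if k: "k \<ge> m + n" for k
      proof -
        have "c ^ (k - m) * L ((S ^^ k) x) \<le> \<epsilon>" using small[of "k - m"] k by simp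
        moreover have "c ^ n * L ((S ^^ k) x) \<le> c ^ (k - m) * L ((S ^^ k) x)"
          using k c(1) L_nonneg[OF box_orthant[OF Sigma_box[OF S_funpow_Sigma[OF x, of k]]]]
          by (intro mult_right_mono power_increasing) auto
        ultimately have "c ^ n * L ((S ^^ k) x) \<le> \<epsilon>" by linarith
        then show ?thesis using c(1) by (simp add: field_simps)
      qed
      then have "alpha_limit T r x \<subseteq> {z. L z \<le> \<epsilon> * (1 / c) ^ n}"
        by (intro alpha_limit_subset[of _ "m + n"] closed_Collect_le continuous_intros cont_L) auto
      then show ?thesis using z by blast
    qed
    then show "L z \<le> 0" using LIMSEQ_le_const[OF lim] by force
  qed
  then have "alpha_limit T r x \<subseteq> \<Sigma> \<inter> face_V H"
    using alpha_limit_Sigma[OF x] L_eq_0_iff[OF box_orthant[OF Sigma_box]] by blast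
  then show "x \<in> Sigma_V H T r q" using x by (simp add: Sigma_V_def)
qed

section \<open>Ordered backward orbits and unorderedness\<close>

text \<open>Larger \<open>n\<close> means further back in time. The ratios of the
  \<open>i\<close>-th coordinates decrease and stay nonnegative, so their decrements tend to 0, and
  these decrements control \<open>X n $ i\<close>.\<close>

lemma backward_orbit_tendsto_0:
  assumes i: "i \<in> H"
    and X: "\<And>n. X n \<in> {0..r}" "\<And>n. T (X (Suc n)) = X n"
    and Y: "\<And>n. Y n \<in> {0..r}" "\<And>n. T (Y (Suc n)) = Y n"
    and le: "\<And>n. leK H (X n) (Y n)"
    and strict: "\<And>n. Y n $ i \<noteq> 0 \<Longrightarrow> X n $ i < Y n $ i"
  shows "(\<lambda>n. X n $ i) \<longlonglongrightarrow> 0"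
proof -
  have X0: "0 \<le> X n $ i" and Y0: "0 \<le> Y n $ i" and XY: "X n $ i \<le> Y n $ i" for n
    using X(1)[of n] Y(1)[of n] le[of n] i unfolding box_iff leK_iff by blast+
  have Y0_iff: "Y (Suc n) $ i = 0 \<longleftrightarrow> Y n $ i = 0" for n
    using T_nth_0_iff[OF box_orthant[OF Y(1)], of "Suc n" i] Y(2)[of n] by simp
  have Y_zero: "Y n $ i = 0 \<longleftrightarrow> Y 0 $ i = 0" for n
    by (induction n) (simp_all add: Y0_iff)
  show ?thesis
  proof (cases "Y 0 $ i = 0")
    case True
    then have "X n $ i = 0" for n using Y_zero X0[of n] XY[of n] by simp
    then show ?thesis by simp
  next
    case False
    then have Ypos: "Y n $ i > 0" and less: "X n $ i < Y n $ i" for n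
      using Y_zero Y0[of n] strict[of n] by (auto simp: order_less_le)
    define \<rho> where "\<rho> n = X n $ i / Y n $ i" for n
    have \<rho>: "0 \<le> \<rho> n" "\<rho> n < 1" for n
      using X0[of n] Ypos[of n] less[of n] by (auto simp: \<rho>_def)
    obtain c where c: "c > 0" "\<And>x y. x \<in> {0..r} \<Longrightarrow> y \<in> {0..r} \<Longrightarrow> leK H x y \<Longrightarrow>
        c * (y $ i - x $ i) \<le> f x $ i - f y $ i"
      using f_diff_ge[OF i] by metis
    obtain z where z: "z \<in> {0..r}" "\<And>w. w \<in> {0..r} \<Longrightarrow> f w $ i \<le> f z $ i"
      using continuous_attains_sup[OF compact_box _ cont_f_nth[OF box_sub, of i]] X(1) by blast
    define M where "M = f z $ i"
    have M: "M > 0" unfolding M_def by (rule f_pos[OF box_orthant[OF z(1)]])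
    have drop: "\<rho> (Suc n) + c / M * (X (Suc n) $ i * (1 - \<rho> (Suc n))) \<le> \<rho> n" for n
    proof -
      let ?x = "X (Suc n)" and ?y = "Y (Suc n)"
      have fy: "0 < f ?y $ i" "f ?y $ i \<le> M"
        using f_pos[OF box_orthant[OF Y(1)]] z(2)[OF Y(1)] by (auto simp: M_def)
      have "\<rho> n = ?x $ i * f ?x $ i / (?y $ i * f ?y $ i)"
        unfolding \<rho>_def using X(2)[of n] Y(2)[of n] T_nth by metis
      \<comment> \<open>The quotient \<open>f ?x $ i / f ?y $ i\<close> is split as 1 plus a
        remainder, to which the estimate \<open>c(2)\<close> and the upper bound \<open>M\<close> of
        \<open>f\<close> apply.\<close>
      also have "\<dots> = \<rho> (Suc n) + \<rho> (Suc n) * ((f ?x $ i - f ?y $ i) / f ?y $ i)"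
        using fy Ypos[of "Suc n"] unfolding \<rho>_def by (simp add: field_simps)
      finally have eq: "\<rho> n = \<rho> (Suc n) + \<rho> (Suc n) * ((f ?x $ i - f ?y $ i) / f ?y $ i)" .
      have "c * (?y $ i - ?x $ i) \<le> f ?x $ i - f ?y $ i" by (intro c(2) X Y le)
      moreover have "0 \<le> c * (?y $ i - ?x $ i)" using c(1) XY[of "Suc n"] by simp
      ultimately have "c * (?y $ i - ?x $ i) / M \<le> (f ?x $ i - f ?y $ i) / f ?y $ i"
        using fy M by (intro frac_le) auto
      then have "\<rho> (Suc n) * (c * (?y $ i - ?x $ i) / M) \<le> \<rho> (Suc n) * ((f ?x $ i - f ?y $ i) / f ?y $ i)"
        using \<rho>(1) by (rule mult_left_mono)
      moreover have "\<rho> (Suc n) * (c * (?y $ i - ?x $ i) / M) = c / M * (?x $ i * (1 - \<rho> (Suc n)))"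
        using Ypos[of "Suc n"] M unfolding \<rho>_def by (simp add: field_simps)
      ultimately show ?thesis using eq by linarith
    qed
    have dec: "\<rho> (Suc n) \<le> \<rho> n" for n
    proof -
      have "0 \<le> c / M * (X (Suc n) $ i * (1 - \<rho> (Suc n)))"
        using c(1) M X0[of "Suc n"] \<rho>(2)[of "Suc n"] by simp
      then show ?thesis using drop[of n] by linarith
    qed
    then have decseq: "decseq \<rho>" by (simp add: decseq_Suc_iff)
    then obtain l where l: "\<rho> \<longlonglongrightarrow> l" using decseq_convergent[of \<rho> 0] \<rho>(1) by blast
    \<comment> \<open>All ratios are at most \<open>\<rho> 0 < 1\<close>, so the factor
      \<open>1 - \<rho> (Suc n)\<close> in \<open>drop\<close> is at least
      \<open>1 - \<rho> 0\<close>.\<close>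
    define d where "d = c / M * (1 - \<rho> 0)"
    have d: "d > 0" unfolding d_def using c(1) M \<rho>(2)[of 0] by simp
    have bound: "X (Suc n) $ i \<le> (\<rho> n - \<rho> (Suc n)) / d" for n
    proof -
      have "\<rho> (Suc n) \<le> \<rho> 0" using decseq by (simp add: decseq_def)
      then have "d * X (Suc n) $ i \<le> c / M * (X (Suc n) $ i * (1 - \<rho> (Suc n)))"
        using c(1) M X0[of "Suc n"] unfolding d_def
        by (simp only: mult.assoc mult.commute[of "1 - \<rho> 0"]) (intro mult_left_mono, auto)
      then show ?thesis using drop[of n] d by (simp add: field_simps)
    qed
    have "(\<lambda>n. (\<rho> n - \<rho> (Suc n)) / d) \<longlonglongrightarrow> (l - l) / d"
      using d by (intro tendsto_divide tendsto_diff l LIMSEQ_Suc[OF l] tendsto_const) simp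
    then have "(\<lambda>n. (\<rho> n - \<rho> (Suc n)) / d) \<longlonglongrightarrow> 0" by simp
    from tendsto_sandwich[OF _ _ tendsto_const this, of "\<lambda>n. X (Suc n) $ i"]
    have "(\<lambda>n. X (Suc n) $ i) \<longlonglongrightarrow> 0"
      by (simp add: X0 bound)
    then show ?thesis by (rule LIMSEQ_imp_Suc)
  qed
qed

text \<open>All H-coordinates tend to 0 backwards, so \<open>L\<close> falls below a threshold.
  Indices start at \<open>Suc n\<close> because type-K retrotonicity yields strictness only for
  preimages.\<close>

lemma backward_orbit_Sigma_V:
  assumes x: "x \<in> \<Sigma>" and y: "y \<in> \<Sigma>"
    and le: "\<And>n. leK H ((S ^^ Suc n) x) ((S ^^ Suc n) y)"
    and strict: "\<And>n i. i \<in> H \<Longrightarrow> (S ^^ Suc n) y $ i \<noteq> 0 \<Longrightarrow> (S ^^ Suc n) x $ i < (S ^^ Suc n) y $ i"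
  shows "x \<in> Sigma_V H T r q"
proof -
  obtain \<epsilon> where \<epsilon>: "threshold \<epsilon>" using threshold_exists ..
  have "(\<lambda>n. (S ^^ Suc n) x $ i) \<longlonglongrightarrow> 0" if "i \<in> H" for i
    by (rule backward_orbit_tendsto_0[OF that, of _ "\<lambda>n. (S ^^ Suc n) y"])
      (use that le strict in \<open>blast intro: x y Sigma_box S_funpow_Sigma T_S_funpow_Suc\<close>)+
  then have "(\<lambda>n. L ((S ^^ Suc n) x)) \<longlonglongrightarrow> (\<Sum>i\<in>H. 0)"
    unfolding coord_sum_def by (rule tendsto_sum)
  then have "\<forall>\<^sub>F n in sequentially. L ((S ^^ Suc n) x) < \<epsilon>"
    using thresholdD(1)[OF \<epsilon>] by (intro order_tendstoD(2)) auto
  then obtain n where "L ((S ^^ Suc n) x) < \<epsilon>"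
    using eventually_happens'[OF sequentially_bot] by blast
  then show ?thesis using Sigma_V_iff[OF \<epsilon> x] by blast
qed

text \<open>Weak retrotonicity only transmits strictness that is already present in the images; the
  induction therefore carries strictness in every H-coordinate along.\<close>

lemma llK_unordered:
  assumes weak: "weakly_typeK_retrotone_on H T {0..r}"
  shows "unordered_in (llK H) (\<Sigma> - Sigma_V H T r q)"
  unfolding unordered_in_def
proof safe
  fix x y assume x: "x \<in> \<Sigma>" "x \<notin> Sigma_V H T r q" and y: "y \<in> \<Sigma>" and "llK H x y"
  have "lessK H ((S ^^ n) x) ((S ^^ n) y) \<and> (\<forall>i\<in>H. (S ^^ n) x $ i < (S ^^ n) y $ i)" for n
  proof (induction n)
    case 0
    obtain i where "i \<in> H" using H_ne by blast
    then show ?case using llK_imp[OF \<open>llK H x y\<close>] by (auto simp: lessK_def)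
  next
    case (Suc n)
    have "lessK H (T ((S ^^ Suc n) x)) (T ((S ^^ Suc n) y))"
      "\<forall>i\<in>H. T ((S ^^ Suc n) x) $ i < T ((S ^^ Suc n) y) $ i"
      unfolding T_S_funpow_Suc[OF x(1)] T_S_funpow_Suc[OF y] using Suc by blast+
    then show ?case
      using weak Sigma_box[OF S_funpow_Sigma[OF x(1)]] Sigma_box[OF S_funpow_Sigma[OF y]]
      unfolding weakly_typeK_retrotone_on_def by blast
  qed
  then have "x \<in> Sigma_V H T r q"
    by (intro backward_orbit_Sigma_V[OF x(1) y]) (auto simp: lessK_def simp del: funpow.simps)
  with x(2) show False ..
qed

text \<open>Retrotonicity creates strictness afresh in each pull-back, so the induction carries only
  \<open>lessK\<close>.\<close>

lemma lessK_unordered: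
  assumes retro: "typeK_retrotone_on H T {0..r}"
  shows "unordered_in (lessK H) (\<Sigma> - Sigma_V H T r q)"
  unfolding unordered_in_def
proof safe
  fix x y assume x: "x \<in> \<Sigma>" "x \<notin> Sigma_V H T r q" and y: "y \<in> \<Sigma>" and "lessK H x y"
  have pull_back: "lessK H ((S ^^ Suc n) x) ((S ^^ Suc n) y) \<and>
      (\<forall>i\<in>H. (S ^^ Suc n) y $ i \<noteq> 0 \<longrightarrow> (S ^^ Suc n) x $ i < (S ^^ Suc n) y $ i)"
    if "lessK H ((S ^^ n) x) ((S ^^ n) y)" for n
  proof -
    have "lessK H (T ((S ^^ Suc n) x)) (T ((S ^^ Suc n) y))"
      unfolding T_S_funpow_Suc[OF x(1)] T_S_funpow_Suc[OF y] by (rule that)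
    then show ?thesis
      using retro Sigma_box[OF S_funpow_Sigma[OF x(1)]] Sigma_box[OF S_funpow_Sigma[OF y]]
      unfolding typeK_retrotone_on_def by blast
  qed
  have "lessK H ((S ^^ n) x) ((S ^^ n) y)" for n
    by (induction n) (use \<open>lessK H x y\<close> pull_back in auto)
  then have "x \<in> Sigma_V H T r q"
    using pull_back by (intro backward_orbit_Sigma_V[OF x(1) y]) (auto simp: lessK_def simp del: funpow.simps)
  with x(2) show False ..
qed

section \<open>The set Sigma_0 and the decomposition of \<Sigma>\<close>

lemma complement: "typeK_system (- H) f T r q"
  using typeK_system_axioms
  unfolding typeK_system_def typeK_competitive_Compl double_complement
  by (elim conjE) (intro conjI; assumption)

text \<open>Off both faces, orbits end above a threshold for the H-sum and above one for the V-sum.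
  The scheme is applied to the set \<open>A\<close> of points above both.\<close>

lemma Sigma_0_attractor:
  "global_attractor_on T (orthant - (face_H H \<union> face_V H)) (Sigma_0 H T r q)"
proof -
  interpret C: typeK_system "- H" f T r q by (rule complement)
  obtain \<epsilon> where \<epsilon>: "threshold \<epsilon>" using threshold_exists ..
  obtain \<delta> where \<delta>: "C.threshold \<delta>" using C.threshold_exists ..
  let ?Y = "orthant - (face_H H \<union> face_V H)"
  define A where "A = {x. \<epsilon> \<le> L x} \<inter> {x. \<delta> \<le> coord_sum (- H) x}"
  have A_inv: "T x \<in> A" if "x \<in> {0..r}" "x \<in> A" for x
    using thresholdD(2)[OF \<epsilon>] C.thresholdD(2)[OF \<delta>] that unfolding A_def by (force simp: less_imp_le)
  have "global_attractor_on T ?Y (\<Inter>n. (T ^^ n) ` (D \<inter> A))"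
  proof (rule attractor)
    show "?Y \<subseteq> orthant - {0}" by (auto simp: face_V_def)
    show "T ` ?Y \<subseteq> ?Y"
      using T_orthant face_V_T_iff C.face_V_T_iff unfolding face_V_Compl by blast
    show "?Y \<noteq> {}"
    proof -
      obtain i j where "i \<in> H" "j \<notin> H" using H_ne V_ne by blast
      then have "r \<in> ?Y" using r_pos by (auto simp: open_orthant_def orthant_def face_H_def face_V_def less_imp_le order_less_le)
      then show ?thesis by blast
    qed
    show "closed A"
      unfolding A_def by (intro closed_Int closed_Collect_le continuous_intros cont_L C.cont_L)
    show "T ` ({0..r} \<inter> A) \<subseteq> A" using A_inv by blast
    show "D \<inter> A \<subseteq> ?Y"
    proof
      fix x assume "x \<in> D \<inter> A"
      then have x: "x \<in> orthant" "x \<in> A" using box_orthant by blast+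
      then show "x \<in> ?Y"
        using L_eq_0_iff[OF x(1)] C.L_eq_0_iff[OF x(1)] thresholdD(1)[OF \<epsilon>] C.thresholdD(1)[OF \<delta>]
        unfolding face_V_Compl A_def by auto
    qed
    fix x assume "x \<in> ?Y"
    then have x: "x \<in> orthant" "x \<notin> face_V H" "x \<notin> face_V (- H)" by (auto simp: face_V_Compl)
    obtain N where N: "\<And>n. n \<ge> N \<Longrightarrow> \<epsilon> < L ((T ^^ n) x)"
      using eventually_above_threshold[OF \<epsilon> x(1,2)] by blast
    obtain M where M: "\<And>n. n \<ge> M \<Longrightarrow> \<delta> < coord_sum (- H) ((T ^^ n) x)"
      using C.eventually_above_threshold[OF \<delta> x(1,3)] by blast
    \<comment> \<open>The strict inequalities give an open set inside \<open>A\<close> that contains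
      the orbit at all late times.\<close>
    define W where "W = {x. \<epsilon> < L x} \<inter> {x. \<delta> < coord_sum (- H) x}"
    have "open W"
      unfolding W_def by (intro open_Int open_Collect_less continuous_intros cont_L C.cont_L)
    moreover have "W \<subseteq> A" unfolding W_def A_def by auto
    moreover have "(T ^^ n) x \<in> W" if "n \<ge> max N M" for n
      using N[of n] M[of n] that unfolding W_def by simp
    ultimately show "\<exists>N. \<forall>n\<ge>N. \<exists>W. open W \<and> (T ^^ n) x \<in> W \<and> W \<inter> ?Y \<subseteq> A" by blast
  qed
  moreover have "(\<Inter>n. (T ^^ n) ` (D \<inter> A)) = {x \<in> \<Sigma>. \<forall>n. (S ^^ n) x \<in> A}"
    by (rule Inter_D_Int) (rule A_inv)
  \<comment> \<open>By \<open>Sigma_V_iff\<close> at \<open>H\<close> and at \<open>- H\<close>, a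
    backward orbit leaves \<open>A\<close> exactly when its starting point is in
    \<open>Sigma_V\<close> or \<open>Sigma_H\<close>.\<close>
  moreover have "(\<forall>n. (S ^^ n) x \<in> A) \<longleftrightarrow> x \<notin> Sigma_V H T r q \<and> x \<notin> Sigma_H H T r q"
    if "x \<in> \<Sigma>" for x
  proof -
    have "(\<forall>n. (S ^^ n) x \<in> A) \<longleftrightarrow>
        \<not> (\<exists>n. L ((S ^^ n) x) < \<epsilon>) \<and> \<not> (\<exists>n. coord_sum (- H) ((S ^^ n) x) < \<delta>)"
      unfolding A_def Int_iff mem_Collect_eq not_less[symmetric] by blast
    then show ?thesis
      unfolding Sigma_V_iff[OF \<epsilon> that] C.Sigma_V_iff[OF \<delta> that, unfolded Sigma_V_Compl] .
  qed
  then have "{x \<in> \<Sigma>. \<forall>n. (S ^^ n) x \<in> A} = Sigma_0 H T r q"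
    unfolding Sigma_0_def by blast
  ultimately show ?thesis by simp
qed

text \<open>A nonempty limit set inside both faces would consist of 0, which is not in
  \<Sigma>.\<close>

lemma Sigma_H_Sigma_V_disjoint: "Sigma_H H T r q \<inter> Sigma_V H T r q = {}"
proof -
  have "x \<notin> Sigma_V H T r q" if x: "x \<in> Sigma_H H T r q" for x
  proof
    assume "x \<in> Sigma_V H T r q"
    moreover obtain z where "z \<in> alpha_limit T r x"
      using alpha_limit_nonempty x unfolding Sigma_H_def by blast
    ultimately have z: "z \<in> \<Sigma>" "z \<in> face_H H" "z \<in> face_V H"
      using x unfolding Sigma_H_def Sigma_V_def by blast+
    then have "z = 0" by (auto simp: face_H_def face_V_def vec_eq_iff)
    then show False using z(1) Sigma_D zero_notin_D by blast
  qed
  then show ?thesis by blast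
qed

text \<open>Disjointness turns the unions into complements in \<Sigma>, the form in which
  unorderedness is proved.\<close>

lemma Sigma_H_Un_Sigma_0: "Sigma_H H T r q \<union> Sigma_0 H T r q = \<Sigma> - Sigma_V H T r q"
  and Sigma_V_Un_Sigma_0: "Sigma_V H T r q \<union> Sigma_0 H T r q = \<Sigma> - Sigma_H H T r q"
  using Sigma_H_Sigma_V_disjoint unfolding Sigma_0_def Sigma_H_def Sigma_V_def by blast+

end

theorem proposition4:
  fixes H :: "'n::finite set"
    and f T :: "real^'n \<Rightarrow> real^'n"
    and r q :: "real^'n"
  assumes "CARD('n) \<ge> 2" and "1 \<le> card H" and "card H < CARD('n)"
    and "f ` orthant \<subseteq> orthant" and "C1_on orthant f"
    and "\<forall>x\<in>orthant. \<forall>i. f x $ i > 0"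
    and "T = kolmogorov_map f"
    and "typeK_competitive H f"
    and "\<forall>i. f 0 $ i > 1"
    and "dissipative T"
    and "r \<in> open_orthant"
    and "\<forall>x\<in>orthant. \<forall>\<^sub>F n in sequentially. (T ^^ n) x \<in> {0..r}"
    and "T ` {0..r} \<subseteq> half_open_box r"
    and "\<exists>g. homeomorphism {0..r} (T ` {0..r}) T g"
    and "weakly_typeK_retrotone_on H T {0..r}"
    and "vll 0 q" and "vll q r"
    and "\<forall>x\<in>{0..q}. \<forall>i. f x $ i > 1"
    and "T ` ({0..r} - half_open_box q) \<subseteq> {0..r} - half_open_box q"
    and "{0..q} \<subseteq> T ` {0..q}"
  shows
    "Sigma_H H T r q \<inter> face_H H = Sigma_set T r q \<inter> face_H H \<and>
     global_attractor_on T (face_H H - {0}) (Sigma_set T r q \<inter> face_H H) \<and>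
     repeller_on T (Sigma_set T r q) (Sigma_set T r q \<inter> face_H H) \<and>
     Sigma_V H T r q \<inter> face_V H = Sigma_set T r q \<inter> face_V H \<and>
     global_attractor_on T (face_V H - {0}) (Sigma_set T r q \<inter> face_V H) \<and>
     repeller_on T (Sigma_set T r q) (Sigma_set T r q \<inter> face_V H) \<and>
     Sigma_0 H T r q \<noteq> {} \<and> compact (Sigma_0 H T r q) \<and>
     T ` Sigma_0 H T r q = Sigma_0 H T r q \<and>
     global_attractor_on T (orthant - (face_H H \<union> face_V H)) (Sigma_0 H T r q) \<and>
     unordered_in (llK H) (Sigma_H H T r q \<union> Sigma_0 H T r q) \<and>
     unordered_in (llK H) (Sigma_V H T r q \<union> Sigma_0 H T r q) \<and>
     (typeK_retrotone_on H T {0..r} \<longrightarrow>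
        unordered_in (lessK H) (Sigma_H H T r q \<union> Sigma_0 H T r q) \<and>
        unordered_in (lessK H) (Sigma_V H T r q \<union> Sigma_0 H T r q))"
proof -
  let ?\<Sigma> = "Sigma_set T r q"
  interpret typeK_system H f T r q
  proof unfold_locales
    show "H \<noteq> {}" using assms(2) by auto
    show "- H \<noteq> {}"
    proof
      assume "- H = {}"
      then have "H = UNIV" by blast
      then show False using assms(3) by simp
    qed
    show "inj_on T {0..r}" using assms(14) homeomorphism_apply1 by (metis inj_on_inverseI)
    show "f x $ i > 0" if "x \<in> orthant" for x i using assms(6) that by blast
    show "f 0 $ i > 1" for i using assms(9) by blast
    show "\<forall>\<^sub>F n in sequentially. (T ^^ n) x \<in> {0..r}" if "x \<in> orthant" for x
      using assms(12) that by blast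
    show "f x $ i > 1" if "x \<in> {0..q}" for x i using assms(18) that by blast
  qed (fact assms)+
  interpret C: typeK_system "- H" f T r q by (rule complement)
  note C_face = C.Sigma_V_face_V C.face_V_attractor C.face_V_repeller
  note faces = Sigma_V_face_V face_V_attractor face_V_repeller C_face[unfolded face_V_Compl Sigma_V_Compl]
  \<comment> \<open>The instance at \<open>- H\<close> speaks of the reversed order; exchanging the
    two points restores the original one.\<close>
  have weak: "unordered_in (llK H) (?\<Sigma> - Sigma_V H T r q)"
    "unordered_in (llK H) (?\<Sigma> - Sigma_H H T r q)"
    using llK_unordered[OF assms(15)] C.llK_unordered assms(15)
    unfolding weakly_typeK_retrotone_on_Compl Sigma_V_Compl unordered_in_def llK_Compl by blast+
  have "unordered_in (lessK H) (?\<Sigma> - Sigma_V H T r q) \<and>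
      unordered_in (lessK H) (?\<Sigma> - Sigma_H H T r q)" if "typeK_retrotone_on H T {0..r}"
    using lessK_unordered[OF that] C.lessK_unordered that
    unfolding typeK_retrotone_on_Compl Sigma_V_Compl unordered_in_def lessK_Compl by blast
  with faces weak Sigma_0_attractor show ?thesis
    unfolding Sigma_H_Un_Sigma_0 Sigma_V_Un_Sigma_0
    unfolding global_attractor_on_def[of T _ "Sigma_0 H T r q"] by blast
qed

end
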